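(* Consider the planar four-vortex problem with circulations $\Gamma_1=\Gamma_2=1$ and $\Gamma_3=\Gamma_4=m$, with $-1<m<1$. The vector $z=(1,0,-1,0,x_3,y_3,x_4,y_4)$ gives an asymmetric relative equilibrium, where $$x_3=\tfrac12\sqrt{3m+5}\left(\sqrt{m+1}-\sqrt{1-m}\right),\qquad y_3=\tfrac{\sqrt3}{2}\left(m+1+\sqrt{1-m^2}\right),$$ $$x_4=\tfrac12\sqrt{3m+5}\left(\sqrt{m+1}+\sqrt{1-m}\right),\qquad y_4=-\tfrac{\sqrt3}{2}\left(m+1-\sqrt{1-m^2}\right).$$ For $0<m<1$, the configuration is concave with vortex $1$ in the interior, while for $-1<m<0$, the configuration is convex with adjacent equal pairs of vortices. The transition from concave to convex configuration at $m=0$ is smooth. All solutions, regardless of the value of $m$, have the same angular velocity $\omega=1/2$. For each $m\in(-1,1)$, there are a total of eight asymmetric relative equilibria, each geometrically equivalent to the given solution $z$.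
   Context: Planar four-vortex problem: vortices at $z_i=(x_i,y_i)\in\mathbb{R}^2$ with circulations $\Gamma_i$, $z=(z_1,\dots,z_4)\in\mathbb{R}^8$ (so $z_1=(1,0)$, $z_2=(-1,0)$, $z_3=(x_3,y_3)$, $z_4=(x_4,y_4)$), $r_{ij}=\|z_i-z_j\|$, $\Gamma=\sum_i\Gamma_i\ne0$, center of vorticity $c=\frac1\Gamma\sum_i\Gamma_iz_i$. A relative equilibrium is a collision-free $z$ satisfying, for some $\omega\ne0$ (the angular velocity), $\sum_{j\ne i}\frac{\Gamma_i\Gamma_j}{r_{ij}^2}(z_j-z_i)+\omega\Gamma_i(z_i-c)=0$ for all $i$. At the single value $m=0$ this is understood with each equation divided by $\Gamma_i$. Asymmetric means noncollinear and without any axis of symmetry. A configuration is concave if one vortex lies strictly inside the convex hull of the other three, and convex if no vortex is contained in the convex hull of the other three; "adjacent equal pairs" means that vortices 1 and 2 are adjacent vertices of the convex quadrilateral, as are vortices 3 and 4. "Smooth transition" means the coordinates $x_3,y_3,x_4,y_4$ are smooth functions of $m$ at $m=0$. Relative equilibria are counted with labeled vortices up to translation, positive scaling and rotation (reflections and relabelings count as distinct). Two are geometrically equivalent if they have the same shape, i.e. agree (up to translation, scaling, rotation) after a reflection and/or interchanging vortices 1 and 2 and/or interchanging vortices 3 and 4. The statement about $\omega=1/2$ refers to the scaling with $z_1=(1,0)$, $z_2=(-1,0)$. *)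

theory Defs
  imports "HOL-Analysis.Analysis"
begin

text \<open>
  A configuration is a vector z of type (real^2)^4: the component z $ i is the position of vortex i
  in the plane, where i ranges over the four-element numeral type 4 (with elements 1, 2, 3, 4 = 0).
\<close>

definition center_of_vorticity :: "real^4 \<Rightarrow> real^2^4 \<Rightarrow> real^2" where
  "center_of_vorticity \<Gamma> z = (1 / (\<Sum>i\<in>UNIV. \<Gamma> $ i)) *\<^sub>R (\<Sum>i\<in>UNIV. \<Gamma> $ i *\<^sub>R z $ i)"

definition collision_free :: "real^2^4 \<Rightarrow> bool" where
  "collision_free z \<longleftrightarrow> (\<forall>i j. i \<noteq> j \<longrightarrow> z $ i \<noteq> z $ j)"

text \<open>
  The equation of vortex i.  For a vortex of zero circulation the equation would be void; there it
  is understood as divided by \<open>\<Gamma> $ i\<close>.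
\<close>
definition vortex_equation :: "real^4 \<Rightarrow> real \<Rightarrow> real^2^4 \<Rightarrow> 4 \<Rightarrow> bool" where
  "vortex_equation \<Gamma> \<omega> z i \<longleftrightarrow>
    (if \<Gamma> $ i = 0
     then (\<Sum>j\<in>UNIV - {i}. (\<Gamma> $ j / (dist (z $ i) (z $ j))\<^sup>2) *\<^sub>R (z $ j - z $ i))
            + \<omega> *\<^sub>R (z $ i - center_of_vorticity \<Gamma> z) = 0
     else (\<Sum>j\<in>UNIV - {i}. (\<Gamma> $ i * \<Gamma> $ j / (dist (z $ i) (z $ j))\<^sup>2) *\<^sub>R (z $ j - z $ i))
            + (\<omega> * \<Gamma> $ i) *\<^sub>R (z $ i - center_of_vorticity \<Gamma> z) = 0)"

definition relative_equilibrium_with :: "real^4 \<Rightarrow> real \<Rightarrow> real^2^4 \<Rightarrow> bool" where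
  "relative_equilibrium_with \<Gamma> \<omega> z \<longleftrightarrow>
     \<omega> \<noteq> 0 \<and> collision_free z \<and> (\<forall>i. vortex_equation \<Gamma> \<omega> z i)"

definition relative_equilibrium :: "real^4 \<Rightarrow> real^2^4 \<Rightarrow> bool" where
  "relative_equilibrium \<Gamma> z \<longleftrightarrow> (\<exists>\<omega>. relative_equilibrium_with \<Gamma> \<omega> z)"

text \<open>Reflection of the plane in the line through p with normal vector v.\<close>
definition reflect_in_line :: "real^2 \<Rightarrow> real^2 \<Rightarrow> real^2 \<Rightarrow> real^2" where
  "reflect_in_line p v x = x - (2 * (v \<bullet> (x - p)) / (v \<bullet> v)) *\<^sub>R v"

definition has_symmetry_axis :: "real^2^4 \<Rightarrow> bool" where
  "has_symmetry_axis z \<longleftrightarrow>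
     (\<exists>p v. v \<noteq> 0 \<and> reflect_in_line p v ` range (($) z) = range (($) z))"

definition asymmetric :: "real^2^4 \<Rightarrow> bool" where
  "asymmetric z \<longleftrightarrow> \<not> collinear (range (($) z)) \<and> \<not> has_symmetry_axis z"

definition concave_with_interior_vortex :: "4 \<Rightarrow> real^2^4 \<Rightarrow> bool" where
  "concave_with_interior_vortex i z \<longleftrightarrow> z $ i \<in> interior (convex hull (($) z ` (UNIV - {i})))"

definition convex_configuration :: "real^2^4 \<Rightarrow> bool" where
  "convex_configuration z \<longleftrightarrow> (\<forall>i. z $ i \<notin> convex hull (($) z ` (UNIV - {i})))"

definition adjacent_vertices :: "4 \<Rightarrow> 4 \<Rightarrow> real^2^4 \<Rightarrow> bool" where
  "adjacent_vertices i j z \<longleftrightarrow>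
     closed_segment (z $ i) (z $ j) edge_of convex hull (range (($) z))"

text \<open>Equality up to translation, positive scaling and rotation, respecting the labels.\<close>
definition similar_configurations :: "real^2^4 \<Rightarrow> real^2^4 \<Rightarrow> bool" where
  "similar_configurations z w \<longleftrightarrow>
     (\<exists>s>0. \<exists>R t. rotation_matrix R \<and> (\<forall>i. w $ i = s *\<^sub>R (R *v z $ i) + t))"

definition similarity_relation :: "((real^2^4) \<times> (real^2^4)) set" where
  "similarity_relation = {(z, w). similar_configurations z w}"

definition reflect_configuration :: "real^2^4 \<Rightarrow> real^2^4" where
  "reflect_configuration z = (\<chi> i. vector [z $ i $ 1, - (z $ i $ 2)])"

definition interchange_vortices :: "4 \<Rightarrow> 4 \<Rightarrow> real^2^4 \<Rightarrow> real^2^4" where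
  "interchange_vortices a b z = (\<chi> i. z $ (Transposition.transpose a b i))"

text \<open>
  Up to rotation and translation every reflection is the reflection in the first coordinate axis,
  so one fixed reflection suffices.
\<close>
definition geometrically_equivalent :: "real^2^4 \<Rightarrow> real^2^4 \<Rightarrow> bool" where
  "geometrically_equivalent z w \<longleftrightarrow>
     (\<exists>f \<in> {id, reflect_configuration}.
      \<exists>g \<in> {id, interchange_vortices 1 2}.
      \<exists>h \<in> {id, interchange_vortices 3 4}.
        similar_configurations (f (g (h z))) w)"

text \<open>Infinite differentiability on a neighbourhood of the point.\<close>
definition smooth_at :: "(real \<Rightarrow> real) \<Rightarrow> real \<Rightarrow> bool" where
  "smooth_at f a \<longleftrightarrow>
     (\<exists>U. open U \<and> a \<in> U \<and> (\<forall>k. \<forall>x\<in>U. (deriv ^^ k) f differentiable (at x)))"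

definition circulations :: "real \<Rightarrow> real^4" where
  "circulations m = vector [1, 1, m, m]"

definition solution :: "real \<Rightarrow> real^2^4" where
  "solution m = vector
    [vector [1, 0],
     vector [- 1, 0],
     vector [1 / 2 * sqrt (3 * m + 5) * (sqrt (m + 1) - sqrt (1 - m)),
             sqrt 3 / 2 * (m + 1 + sqrt (1 - m\<^sup>2))],
     vector [1 / 2 * sqrt (3 * m + 5) * (sqrt (m + 1) + sqrt (1 - m)),
             - (sqrt 3 / 2) * (m + 1 - sqrt (1 - m\<^sup>2))]]"

definition asymmetric_relative_equilibria :: "real \<Rightarrow> (real^2^4) set" where
  "asymmetric_relative_equilibria m = {z. relative_equilibrium (circulations m) z \<and> asymmetric z}"

end

theory Submission
  imports Defs
begin

text \<open>
  Write \<open>S\<^sub>i\<^sub>j = 1 / r\<^sub>i\<^sub>j\<^sup>2 - \<omega> / \<Gamma>\<close>.  The equations say \<open>\<Sum>\<^sub>j \<Gamma>\<^sub>j S\<^sub>i\<^sub>j (z\<^sub>j - z\<^sub>i) = 0\<close>, so in the noncollinear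
  case (Dziobek) \<open>S\<^sub>i\<^sub>j\<close> is proportional to \<open>x\<^sub>i x\<^sub>j\<close>, where \<open>x\<^sub>i = D\<^sub>i / \<Gamma>\<^sub>i\<close> and \<open>D\<^sub>i\<close> are the signed areas
  of the triangles formed by the other three vortices.  The sums \<open>\<Sum>\<^sub>i D\<^sub>i r\<^sub>i\<^sub>j\<^sup>2\<close> do not depend on \<open>j\<close>;
  dividing the resulting relations by \<open>x\<^sub>1 - x\<^sub>2\<close>, \<open>x\<^sub>3 - x\<^sub>4\<close> and \<open>x\<^sub>3 + x\<^sub>4\<close>, whose vanishing would
  force a symmetry axis, leaves three polynomial equations in symmetric functions of the \<open>x\<^sub>i\<close>.
  For \<open>0 < |m| < 1\<close> their only real solutions have a value of \<open>x\<^sub>1 x\<^sub>2\<close> which amounts to \<open>\<omega> r\<^sub>1\<^sub>2\<^sup>2 = 2\<close>, i.e.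
  \<open>\<omega> = 1/2\<close> in the normalization \<open>z\<^sub>1 = 1\<close>, \<open>z\<^sub>2 = -1\<close>.  For \<open>m = 0\<close> vortices 3 and 4 sit at
  equilibria of the restricted three-vortex problem, which are explicit.

  For \<open>\<omega> = 1/2\<close> the equations become \<open>p\<^sup>2 + q\<^sup>2 = 4\<close>, \<open>|p|\<^sup>2 = 8(1 + m)\<close>, \<open>|q|\<^sup>2 = 8 + 4m\<close> in the complex numbers
  \<open>p = z\<^sub>3 + z\<^sub>4\<close> and \<open>q = z\<^sub>3 - z\<^sub>4\<close>: a triangle with sides \<open>4\<close>, \<open>|p|\<^sup>2\<close>, \<open>|q|\<^sup>2\<close>, which is nondegenerate
  exactly because \<open>|m| < 1\<close>.  It determines \<open>(p\<^sup>2, q\<^sup>2)\<close> up to conjugation, hence eight pairs \<open>(p, q)\<close>.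
\<close>

section \<open>The reduced algebraic system\<close>

text \<open>
  For \<open>a = x\<^sub>1 + x\<^sub>2 = - m c\<close> with \<open>c = x\<^sub>3 + x\<^sub>4\<close>, everything symmetric in the two pairs is a polynomial in
  \<open>b = t x\<^sub>1 x\<^sub>2\<close>, \<open>d = t x\<^sub>3 x\<^sub>4\<close> and \<open>X = t c\<^sup>2\<close>.
\<close>
lemma symmetric_function_identities:
  fixes x1 x2 x3 x4 t m :: real
  assumes a: "x1 + x2 + m * (x3 + x4) = 0"
  defines "b \<equiv> t * x1 * x2" and "d \<equiv> t * x3 * x4" and "X \<equiv> t * (x3 + x4)^2"
  shows "(1 + t*x1*x3) * (1 + t*x2*x3) * (1 + t*x1*x4) * (1 + t*x2*x4) = (1 - b*d)^2 + (b - m) * (1 - m*d) * X"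
  "(1 + t*x1*x3) * (1 + t*x2*x3) * (1 + t*x1*x4) * (1 + t*x2*x4) + m * (1 + b) *
     (t * x3^2 * ((1 + t*x1*x4) * (1 + t*x2*x4)) + t * x4^2 * ((1 + t*x1*x3) * (1 + t*x2*x3)))
   = b * (1 + m) * (1 - m*d) * X + (1 - b*d) * (1 - b*d - 2*m*d*(1 + b))"
  "m * ((1 + t*x1*x3) * (1 + t*x2*x3) * (1 + t*x1*x4) * (1 + t*x2*x4)) + (1 + d) *
     (t * x1^2 * ((1 + t*x2*x3) * (1 + t*x2*x4)) + t * x2^2 * ((1 + t*x1*x3) * (1 + t*x1*x4)))
   = m * d * (1 + m) * (m - b) * X + (1 - b*d) * (m * (1 - b*d) - 2*b*(1 + d))"
  "(1 + t*x2*x3) * (1 + t*x1*x4) * (1 + t*x2*x4) + (1 + t*x1*x3) * (1 + t*x1*x4) * (1 + t*x2*x4) +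
   (1 + t*x1*x3) * (1 + t*x2*x3) * (1 + t*x2*x4) + (1 + t*x1*x3) * (1 + t*x2*x3) * (1 + t*x1*x4) 
   = 2 * ((1 - b*d)^2 + (b - m) * (1 - m*d) * X) + 2 * (1 - b*d) * (1 + b*d) - m * (1 - b*d) * X"
proof -
  have x1: "x1 = - x2 - m * x3 - m * x4" using a by (simp add: algebra_simps)
  show "(1 + t*x1*x3) * (1 + t*x2*x3) * (1 + t*x1*x4) * (1 + t*x2*x4) = (1 - b*d)^2 + (b - m) * (1 - m*d) * X"
    unfolding b_def d_def X_def x1 by algebra
  show   "(1 + t*x1*x3) * (1 + t*x2*x3) * (1 + t*x1*x4) * (1 + t*x2*x4) + m * (1 + b) *
     (t * x3^2 * ((1 + t*x1*x4) * (1 + t*x2*x4)) + t * x4^2 * ((1 + t*x1*x3) * (1 + t*x2*x3)))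
   = b * (1 + m) * (1 - m*d) * X + (1 - b*d) * (1 - b*d - 2*m*d*(1 + b))"
    unfolding b_def d_def X_def x1 by algebra
  show   "m * ((1 + t*x1*x3) * (1 + t*x2*x3) * (1 + t*x1*x4) * (1 + t*x2*x4)) + (1 + d) *
     (t * x1^2 * ((1 + t*x2*x3) * (1 + t*x2*x4)) + t * x2^2 * ((1 + t*x1*x3) * (1 + t*x1*x4)))
   = m * d * (1 + m) * (m - b) * X + (1 - b*d) * (m * (1 - b*d) - 2*b*(1 + d))"
    unfolding b_def d_def X_def x1 by algebra
  show "(1 + t*x2*x3) * (1 + t*x1*x4) * (1 + t*x2*x4) + (1 + t*x1*x3) * (1 + t*x1*x4) * (1 + t*x2*x4) +
   (1 + t*x1*x3) * (1 + t*x2*x3) * (1 + t*x2*x4) + (1 + t*x1*x3) * (1 + t*x2*x3) * (1 + t*x1*x4) 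
   = 2 * ((1 - b*d)^2 + (b - m) * (1 - m*d) * X) + 2 * (1 - b*d) * (1 + b*d) - m * (1 - b*d) * X"
    unfolding b_def d_def X_def x1 by algebra
qed

text \<open>
  Both equations are linear in \<open>m B\<close>; their resultant splits into linear factors and one factor
  bilinear in \<open>B\<close> and \<open>D\<close>.
\<close>
lemma resultant_elimination:
  fixes B D m :: real
  defines "T \<equiv> D + B - 2" and "S \<equiv> D + B - 2*B*D"
  assumes F: "(1 + m*B) * T = B * (1 + m*D) * S"
    and G: "(T * (2 + B + 2*m*B) + m*B*S - 2*(1+m)*B*(D+B)) * (D - 1) = (D - B) * (D - B - 2 - 2*m*B)"
    and ne: "B \<noteq> 1" "D \<noteq> 1" "B \<noteq> D"
  shows "D - B - 2 - 2*m*B = 0"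
proof -
  define f1 where "f1 = D+B-2-D^2-B*D+2*B*D^2"
  define f0 where "f0 = D+B-2-B*D-B^2+2*B^2*D"
  define g1 where "g1 = D^2+3*B*D-3*D-2*B*D^2-3*B+4"
  define g0 where "g0 = (D-2-B*D)*(D-2+B)"
  have f: "m*B*f1 + f0 = 0" using F unfolding T_def S_def f1_def f0_def by algebra
  have g: "m*B*g1 + g0 = 0" using G unfolding T_def S_def g1_def g0_def by algebra
  \<comment> \<open>Both equations have the form \<open>m*B*f1 + f0 = 0\<close>, so crosswise
    multiplication eliminates \<open>m*B\<close>. Of the factors found next, only the bilinear one
    can vanish.\<close>
  have "f1 * g0 - f0 * g1 = 0" using f g by algebra
  moreover have "f1 * g0 - f0 * g1 = (B-1)*(D-1)^2*(B-D)*(2*B*D-3*B-D+2)"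
    unfolding f1_def f0_def g1_def g0_def by algebra
  ultimately have c: "2*B*D-3*B-D+2 = 0" using ne by auto
  \<comment> \<open>On the curve \<open>c\<close> the equation \<open>f\<close> yields the claim
    multiplied by the nonzero factor \<open>2 * (D - 1)\<close>.\<close>
  have "(D - B - 2 - 2*m*B) * (D - 1) * 2 = 0" using c f unfolding f1_def f0_def by algebra
  then show ?thesis using ne by auto
qed


text \<open>I and II stem from the vortex pairs 1, 2 and 3, 4, and III from a weighted sum over all
  four; \<open>real\<close> records that \<open>x1\<close> and \<open>x2\<close> are real, through
  the square of \<open>x1 - x2\<close>. If \<open>b\<close> differed from \<open>m\<close>,
  eliminating \<open>N\<close> and \<open>X\<close> would lead to the two equations of
  \<open>resultant_elimination\<close>, whose solution annihilates the second summand of I and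
  thereby contradicts the first.\<close>

lemma reduced_system_solution:
  fixes b d X m :: real
  defines "e \<equiv> 1 - b*d"
  defines "N \<equiv> e^2 + (b - m) * (1 - m*d) * X"
  assumes I: "b * (1 + m) * (1 - m*d) * X + e * (e - 2*m*d*(1 + b)) = 0"
    and II: "m * d * (1 + m) * (m - b) * X + e * (m * e - 2*b*(1 + d)) = 0"
    and III: "(1 + m^2 + 4*m) * N * (1+b) * (1+d) - N * (1+d) - m^2 * N * (1+b)
       = m * (2*N + 2*e*(1 + b*d) - m*e*X) * (1+b) * (1+d)"
    and m: "- 1 < m" "m < 1" "m \<noteq> 0" and nz: "b \<noteq> 0" "d \<noteq> 0" "X \<noteq> 0" "N \<noteq> 0" "1 + b \<noteq> 0" "1 + d \<noteq> 0"
    and real: "X * (m^2*X - 4*b) \<ge> 0"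
  shows "b = m"
proof (rule ccontr)
  assume bm: "b \<noteq> m"
  have m1: "1 + m \<noteq> 0" using m by auto
  have e: "e \<noteq> 0"
  proof
    assume e0: "e = 0"
    then have "b * (1 + m) * (1 - m*d) * X = 0" using I by simp
    then have "1 - m * d = 0" using nz m1 by simp
    then show False using nz(4) e0 unfolding N_def by simp
  qed
  \<comment> \<open>Here reality enters. If \<open>m * d = 1\<close>, then I determines
    \<open>b\<close> and II determines \<open>X\<close>, and for these values the discriminant in
    \<open>real\<close> is negative because \<open>m^2 < 1\<close>.\<close>
  have md: "m * d \<noteq> 1"
  proof
    assume md: "m * d = 1"
    then have d: "d = 1 / m" using m(3) by (simp add: field_simps)
    have "e - 2*m*d*(1 + b) = 0" using I md e by simp
    then have "m + b * (1 + 2*m) = 0" unfolding e_def d using m(3) by (simp add: field_simps)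
    then have b1: "b * (1 + 2*m) = - m" by simp
    have "m * X * (1 + 2*m) = - 2 * (1 + m)"
    proof -
      have e1: "e * (1 + 2*m) = 2 * (1 + m)" using b1 md unfolding e_def
        by algebra
      have mb: "(m - b) * (1 + 2*m) = 2 * m * (1 + m)" using b1 by algebra
      have be: "(m * e - 2*b*(1 + d)) * (1 + 2*m) = 2 * (1 + m)^2" using e1 b1 md by algebra
      have "m * d * (1 + m) * ((m - b) * (1 + 2*m)) * X * (1 + 2*m)
        + (e * (1 + 2*m)) * ((m * e - 2*b*(1 + d)) * (1 + 2*m)) = 0"
        using II by algebra
      then have "(1 + m)^2 * 2 * (m * X * (1 + 2*m) + 2 * (1 + m)) = 0"
        unfolding mb e1 be md by algebra
      then show ?thesis using m1 by auto
    qed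
    then have "X * (m^2*X - 4*b) * (1 + 2*m)^2 = - 4 * ((1 + m) * (1 - m))"
      using b1 by algebra
    also have "\<dots> < 0" using m by simp
    finally show False using mult_nonneg_nonneg[OF real zero_le_power2[of "1 + 2*m"]] by linarith
  qed
  \<comment> \<open>In these variables the excluded coincidences \<open>b = m\<close>,
    \<open>m * d = 1\<close> and \<open>e = 0\<close> read \<open>B = 1\<close>,
    \<open>D = 1\<close> and \<open>B = D\<close>, which are exactly the linear factors of the
    resultant.\<close>
  define B where "B = b / m"
  define D where "D = 1 / (m * d)"
  have Dnz: "D \<noteq> 0" using m(3) nz unfolding D_def by simp
  have b: "b = m * B" and d: "m * d * D = 1" unfolding B_def D_def using m(3) nz by auto
  have B: "B \<noteq> 1" and D: "D \<noteq> 1" using bm md b d by auto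
  have BD: "B \<noteq> D" using e d b unfolding e_def by (auto simp: mult_ac)
  define P where "P = 1 + b*d - 2*m*d"
  define R where "R = m + m*b*d - 2*b"
  \<comment> \<open>Written through \<open>N\<close>, the equations I and II no longer contain
    \<open>X\<close>; comparing the two values of \<open>N\<close> leaves a relation between
    \<open>b\<close>, \<open>d\<close> and \<open>m\<close> alone.\<close>
  have n1: "N * b * (1 + m) = e * m * (1 + b) * (1 + b*d - 2*m*d)"
    using I unfolding N_def e_def by algebra
  have n2: "N * m * d * (1 + m) = e * (1 + d) * (m + m*b*d - 2*b)"
    using II unfolding N_def e_def by algebra
  have "m^2 * d * (1 + b) * (1 + b*d - 2*m*d) = b * (1 + d) * (m + m*b*d - 2*b)"
    using n1 n2 e by algebra
  then have h: "m^2 * d * (1 + b) * P = b * (1 + d) * R" unfolding P_def R_def .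
  have PD: "P * D = D + B - 2" and RD: "R * D = m * (D + B - 2*B*D)"
    and bdD: "(1 + b*d) * D = D + B" and eD: "e * D = D - B" and mdD: "(1 - m*d) * D = D - 1"
    and aD: "(e - 2*m*d*(1 + b)) * D = D - B - 2 - 2*m*B"
    using b d unfolding P_def R_def e_def by algebra+
  \<comment> \<open>Since \<open>m * d * D = 1\<close>, multiplying by powers of \<open>D\<close>
    clears \<open>d\<close> and turns the relation into a polynomial in \<open>B\<close>,
    \<open>D\<close> and \<open>m\<close>.\<close>
  have "(m^2 * d * (1 + b) * P) * D^2 = (b * (1 + d) * R) * D^2" using h by simp
  then have "m * (m*d*D) * (1 + b) * (P*D) = b * (D + d*D) * (R*D)" by (simp add: algebra_simps power2_eq_square)
  then have "m * ((1 + m*B) * (D + B - 2)) = m * (B * (1 + m*D) * (D + B - 2*B*D))"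
    unfolding PD RD d using b d by algebra
  then have F: "(1 + m*B) * (D + B - 2) = B * (1 + m*D) * (D + B - 2*B*D)"
    using m(3) by simp
  have "m * e * (1+b) * (1+d) * (m*d*P * ((1+m)^2*(1+b) - 1) - m*b*R - b*m*d*(1+m)*(2*(1+b*d) - m*X)) = 0"
    using III n1 n2 unfolding P_def R_def by algebra
  then have "m*d*P * ((1+m)^2*(1+b) - 1) - m*b*R - b*m*d*(1+m)*(2*(1+b*d) - m*X) = 0"
    using m(3) e nz by simp
  then have "m*d*P * ((1+m)^2*(1+b) - 1) * (1 - m*d) - m*b*R*(1 - m*d)
     = m*d*(2*b*(1+m)*(1+b*d)*(1 - m*d) + m*e*(e - 2*m*d*(1 + b)))"
    using I by algebra
  then have "(m*d*D)*(P*D) * ((1+m)^2*(1+b) - 1) * ((1 - m*d)*D) - m*b*D*(R*D)*((1 - m*d)*D)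
     = (m*d*D)*(2*b*(1+m)*((1+b*d)*D)*((1 - m*d)*D) + m*(e*D)*((e - 2*m*d*(1 + b))*D))"
    by algebra
  then have "m * (((D + B - 2) * (2 + B + 2*m*B) + m*B*(D + B - 2*B*D) - 2*(1+m)*B*(D+B)) * (D - 1)) = m * ((D - B) * (D - B - 2 - 2*m*B))"
    unfolding PD RD d bdD eD mdD aD unfolding b using F by algebra
  then have G: "((D + B - 2) * (2 + B + 2*m*B) + m*B*(D + B - 2*B*D) - 2*(1+m)*B*(D+B)) * (D - 1) = (D - B) * (D - B - 2 - 2*m*B)"
    using m(3) by simp
  have al: "D - B - 2 - 2*m*B = 0" using resultant_elimination[OF F G B D BD] .
  have "e - 2*m*d*(1 + b) = 0"
    using al aD Dnz by simp
  then have "b * (1 + m) * (1 - m*d) * X = 0" using I by simp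
  then show False using nz m1 md by simp
qed

text \<open>Each \<open>r\<close> is a squared distance multiplied by \<open>L\<close>, and the
  weights \<open>x1\<close>, \<open>x2\<close>, \<open>m*x3\<close>, \<open>m*x4\<close> are the
  oriented areas. The difference of E1 and E2 divided by \<open>x2 - x1\<close> gives I, that of E3
  and E4 divided by \<open>x4 - x3\<close> gives II, and the weighted sum of all four gives III. By
  \<open>r12\<close>, the conclusion says \<open>r12 * (1 + m) = 1\<close>.\<close>

lemma dziobek_product:
  fixes x1 x2 x3 x4 t m :: real
  assumes m: "- 1 < m" "m < 1" "m \<noteq> 0"
    and t: "t \<noteq> 0" and nz: "x1 \<noteq> 0" "x2 \<noteq> 0" "x3 \<noteq> 0" "x4 \<noteq> 0"
    and lin: "x1 + x2 + m * (x3 + x4) = 0"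
    and r12: "r12 * (1 + t*x1*x2) = 1" and r13: "r13 * (1 + t*x1*x3) = 1" and r14: "r14 * (1 + t*x1*x4) = 1"
    and r23: "r23 * (1 + t*x2*x3) = 1" and r24: "r24 * (1 + t*x2*x4) = 1" and r34: "r34 * (1 + t*x3*x4) = 1"
    and E1: "x2*r12 + m*x3*r13 + m*x4*r14 = E" and E2: "x1*r12 + m*x3*r23 + m*x4*r24 = E"
    and E3: "x1*r13 + x2*r23 + m*x4*r34 = E" and E4: "x1*r14 + x2*r24 + m*x3*r34 = E"
    and ne: "x1 \<noteq> x2" "x3 \<noteq> x4" "x3 + x4 \<noteq> 0"
  shows "t * x1 * x2 = m"
proof -
  define b where "b = t * x1 * x2"
  define d where "d = t * x3 * x4"
  define X where "X = t * (x3 + x4)^2"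
  define n13 where "n13 = 1 + t*x1*x3"
  define n14 where "n14 = 1 + t*x1*x4"
  define n23 where "n23 = 1 + t*x2*x3"
  define n24 where "n24 = 1 + t*x2*x4"
  note ns = n13_def n14_def n23_def n24_def
  define e where "e = 1 - b*d"
  define N where "N = e^2 + (b - m) * (1 - m*d) * X"
  note P = symmetric_function_identities[OF lin, of t, folded b_def d_def X_def, folded ns, folded e_def, folded N_def]
  note s = r12[folded b_def] r34[folded d_def] r13[folded n13_def] r14[folded n14_def] r23[folded n23_def] r24[folded n24_def]
  have nnz: "1 + b \<noteq> 0" "1 + d \<noteq> 0" "n13 \<noteq> 0" "n14 \<noteq> 0" "n23 \<noteq> 0" "n24 \<noteq> 0" using s by auto
  have N: "N \<noteq> 0" using P(1) nnz by auto
  \<comment> \<open>Differences of reciprocals of the \<open>n\<close>: each carries the factor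
    \<open>x2 - x1\<close> or \<open>x4 - x3\<close> that is cancelled afterwards.\<close>
  have d1: "r13 - r23 = r13 * r23 * (t * x3 * (x2 - x1))" "r14 - r24 = r14 * r24 * (t * x4 * (x2 - x1))"
    "r13 - r14 = r13 * r14 * (t * x1 * (x4 - x3))" "r23 - r24 = r23 * r24 * (t * x2 * (x4 - x3))"
    using s unfolding ns by algebra+
  have "(x2 - x1) * r12 + m * x3 * (r13 - r23) + m * x4 * (r14 - r24) = 0" using E1 E2 by (simp add: algebra_simps)
  then have "(x2 - x1) * (r12 + m*t*x3^2*r13*r23 + m*t*x4^2*r14*r24) = 0" unfolding d1 by algebra
  then have "r12 + m*t*x3^2*r13*r23 + m*t*x4^2*r14*r24 = 0" using ne by simp
  then have "n13*n23*n14*n24 + m*(1 + b)*(t*x3^2*(n14*n24) + t*x4^2*(n13*n23)) = 0"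
    using s by algebra
  then have I: "b * (1 + m) * (1 - m*d) * X + e * (e - 2*m*d*(1 + b)) = 0"
    using P(2) unfolding e_def by algebra
  have "(x4 - x3) * m * r34 + x1 * (r13 - r14) + x2 * (r23 - r24) = 0" using E3 E4 by (simp add: algebra_simps)
  then have "(x4 - x3) * (m * r34 + t*x1^2*r13*r14 + t*x2^2*r23*r24) = 0" unfolding d1 by algebra
  then have "m * r34 + t*x1^2*r13*r14 + t*x2^2*r23*r24 = 0" using ne by simp
  then have "m * (n13*n23*n14*n24) + (1 + d)*(t*x1^2*(n23*n24) + t*x2^2*(n13*n14)) = 0"
    using s by algebra
  then have II: "m * d * (1 + m) * (m - b) * X + e * (m * e - 2*b*(1 + d)) = 0"
    using P(3) unfolding e_def by algebra
  \<comment> \<open>The weights add up to zero, so the weighted sum of E1 to E4 is twice the sum of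
    weight times weight times \<open>r\<close> over all pairs, and it vanishes. After multiplication
    by \<open>t\<close>, replacing \<open>t*xi*xj*rij\<close> by \<open>1 - rij\<close> makes it
    linear in the \<open>r\<close>.\<close>
  have "x1 * E + x2 * E + m * x3 * E + m * x4 * E = 0" using lin by algebra
  then have "2 * (t*x1*x2*r12 + m^2*(t*x3*x4)*r34 + m*(t*x1*x3*r13 + t*x1*x4*r14 + t*x2*x3*r23 + t*x2*x4*r24)) = 0"
    using E1 E2 E3 E4 by algebra
  moreover have "t*x1*x2*r12 = 1 - r12" "t*x3*x4*r34 = 1 - r34" "t*x1*x3*r13 = 1 - r13" "t*x1*x4*r14 = 1 - r14"
      "t*x2*x3*r23 = 1 - r23" "t*x2*x4*r24 = 1 - r24"
    using r12 r34 r13 r14 r23 r24 by algebra+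
  ultimately have v: "1 + m^2 + 4*m = r12 + m^2*r34 + m*(r13 + r14 + r23 + r24)" by algebra
  have N4: "N * r13 = n23*n14*n24" "N * r14 = n13*n23*n24" "N * r23 = n13*n14*n24" "N * r24 = n13*n23*n14"
    unfolding P(1)[symmetric] using s(3-6) by algebra+
  have "N * (r13 + r14 + r23 + r24) = 2*N + 2*e*(1 + b*d) - m*e*X"
    using N4 P(4) unfolding distrib_left by simp
  then have "(1 + m^2 + 4*m) * N = N*r12 + m^2*(N*r34) + m*(2*N + 2*e*(1 + b*d) - m*e*X)"
    using v by algebra
  then have III: "(1 + m^2 + 4*m) * N * (1+b) * (1+d) - N * (1+d) - m^2 * N * (1+b)
       = m * (2*N + 2*e*(1 + b*d) - m*e*X) * (1+b) * (1+d)"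
    using s(1,2) by algebra
  have "X * (m^2*X - 4*b) = t^2 * (x3 + x4)^2 * ((m*(x3 + x4))^2 - 4*x1*x2)"
    unfolding X_def b_def by algebra
  also have "m * (x3 + x4) = - (x1 + x2)" using lin by simp
  also have "t^2 * (x3 + x4)^2 * ((- (x1 + x2))^2 - 4*x1*x2) = (t * (x3 + x4) * (x1 - x2))^2" by algebra
  finally have real: "X * (m^2*X - 4*b) \<ge> 0" by simp
  show ?thesis
    using reduced_system_solution[of b m d X, folded e_def, folded N_def, OF I II III m _ _ _ N nnz(1,2) real]
      t nz ne unfolding b_def d_def X_def by simp
qed

section \<open>Dziobek equations\<close>

text \<open>Twice the signed area of the triangle \<open>a\<close>, \<open>b\<close>,
  \<open>c\<close>, that is, the cross product of two of its sides.\<close>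

definition tri :: "complex \<Rightarrow> complex \<Rightarrow> complex \<Rightarrow> real" where
  "tri a b c = Im (cnj (b - a) * (c - a))"

text \<open>The cross product of the relation with one of its three vectors removes that term and
  leaves a proportion between two areas.\<close>

lemma tri_relation:
  fixes i j k l :: complex and p q r :: real
  assumes "p *\<^sub>R (j - i) + q *\<^sub>R (k - i) + r *\<^sub>R (l - i) = 0"
  shows "p * tri i j k = r * tri i k l" "p * tri i j l = - q * tri i k l" "q * tri i j k = - r * tri i j l"
proof -
  have "p * (Re j - Re i) + q * (Re k - Re i) + r * (Re l - Re i) = 0"
    "p * (Im j - Im i) + q * (Im k - Im i) + r * (Im l - Im i) = 0"
    using arg_cong[OF assms, of Re] arg_cong[OF assms, of Im] by simp_all
  then show "p * tri i j k = r * tri i k l" "p * tri i j l = - q * tri i k l" "q * tri i j k = - r * tri i j l"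
    unfolding tri_def by (simp, algebra)+
qed

text \<open>With positive squared distances, each equation forces opposite signs on two weights, but
  three nonzero numbers cannot have pairwise opposite signs. This excludes the degenerate case in
  which three vortices are collinear.\<close>

lemma triangle_weights_contradiction:
  fixes a b c :: real
  assumes "R12 > 0" "R13 > 0" "R23 > 0" "a \<noteq> 0" "b \<noteq> 0" "c \<noteq> 0"
    and "b * R12 + c * R13 = 0" "a * R12 + c * R23 = 0" "a * R13 + b * R23 = (0::real)"
  shows False
proof -
  have sg: "x * y < 0" if "x * R + y * R' = 0" "R > 0" "R' > 0" "x \<noteq> 0" "y \<noteq> 0" for x y R R' :: real
  proof -
    have "(x * y) * R = - (y^2 * R')" using that(1) by algebra
    also have "\<dots> < 0" using that by simp
    finally show ?thesis using that(2) by (simp add: mult_less_0_iff)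
  qed
  have "b * c < 0" "a * c < 0" "a * b < 0" using assms by (auto intro!: sg)
  then show False by (auto simp: mult_less_0_iff)
qed

text \<open>\<open>L\<close> stands for the angular velocity divided by the total circulation. The
  last three hypotheses exclude the possible mirror symmetries: an axis bisecting the pair 1, 2, one
  bisecting the pair 3, 4, and an isosceles trapezoid in which both pairs are swapped. In the last
  case the equality of areas rules out a mere parallelogram.\<close>

lemma asymmetric_omega:
  fixes z1 z2 z3 z4 :: complex and L m :: real
  defines "R12 \<equiv> (cmod (z1 - z2))^2" and "R13 \<equiv> (cmod (z1 - z3))^2" and "R14 \<equiv> (cmod (z1 - z4))^2"
    and "R23 \<equiv> (cmod (z2 - z3))^2" and "R24 \<equiv> (cmod (z2 - z4))^2" and "R34 \<equiv> (cmod (z3 - z4))^2"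
  assumes m: "- 1 < m" "m < 1" "m \<noteq> 0" and L: "L \<noteq> 0"
    and dist: "z1 \<noteq> z2" "z1 \<noteq> z3" "z1 \<noteq> z4" "z2 \<noteq> z3" "z2 \<noteq> z4" "z3 \<noteq> z4"
    and eq1: "(1/R12 - L) *\<^sub>R (z2 - z1) + (m * (1/R13 - L)) *\<^sub>R (z3 - z1) + (m * (1/R14 - L)) *\<^sub>R (z4 - z1) = 0"
    and eq2: "(1/R12 - L) *\<^sub>R (z1 - z2) + (m * (1/R23 - L)) *\<^sub>R (z3 - z2) + (m * (1/R24 - L)) *\<^sub>R (z4 - z2) = 0"
    and eq3: "(1/R13 - L) *\<^sub>R (z1 - z3) + (1/R23 - L) *\<^sub>R (z2 - z3) + (m * (1/R34 - L)) *\<^sub>R (z4 - z3) = 0"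
    and eq4: "(1/R14 - L) *\<^sub>R (z1 - z4) + (1/R24 - L) *\<^sub>R (z2 - z4) + (m * (1/R34 - L)) *\<^sub>R (z3 - z4) = 0"
    and noncol: "\<not> (tri z2 z3 z4 = 0 \<and> tri z1 z3 z4 = 0 \<and> tri z1 z2 z4 = 0 \<and> tri z1 z2 z3 = 0)"
    and asym1: "\<not> (R13 = R23 \<and> R14 = R24)" and asym2: "\<not> (R13 = R14 \<and> R23 = R24)"
    and asym3: "\<not> (tri z2 z3 z4 = tri z1 z3 z4 \<and> R13 = R24 \<and> R14 = R23)"
  shows "L * R12 * (1 + m) = 1"
proof -
  define D1 where "D1 = tri z2 z3 z4"
  define D2 where "D2 = - tri z1 z3 z4"
  define D3 where "D3 = tri z1 z2 z4"
  define D4 where "D4 = - tri z1 z2 z3"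
  note Ds = D1_def D2_def D3_def D4_def
  define S12 where "S12 = 1/R12 - L"
  define S13 where "S13 = 1/R13 - L"
  define S14 where "S14 = 1/R14 - L"
  define S23 where "S23 = 1/R23 - L"
  define S24 where "S24 = 1/R24 - L"
  define S34 where "S34 = 1/R34 - L"
  note Ss = S12_def S13_def S14_def S23_def S24_def S34_def
  note Rs = R12_def R13_def R14_def R23_def R24_def R34_def
  have Rpos: "R12 > 0" "R13 > 0" "R14 > 0" "R23 > 0" "R24 > 0" "R34 > 0"
    unfolding Rs using dist by auto
  note eq = eq1[folded Ss] eq2[folded Ss] eq3[folded Ss] eq4[folded Ss]
  have perm: "tri z2 z1 z3 = - tri z1 z2 z3" "tri z2 z1 z4 = - tri z1 z2 z4" "tri z3 z1 z2 = tri z1 z2 z3"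
    "tri z3 z1 z4 = - tri z1 z3 z4" "tri z3 z2 z4 = - tri z2 z3 z4" "tri z4 z1 z2 = tri z1 z2 z4"
    "tri z4 z1 z3 = tri z1 z3 z4" "tri z4 z2 z3 = tri z2 z3 z4"
    unfolding tri_def by (simp_all add: algebra_simps)
  have rel: "S12 * D3 = m * S13 * D2" "S12 * D4 = m * S14 * D2" "m * S13 * D4 = m * S14 * D3"
    "S12 * D3 = m * S23 * D1" "S12 * D4 = m * S24 * D1" "m * S23 * D4 = m * S24 * D3"
    "S13 * D2 = S23 * D1" "S13 * D4 = m * S34 * D1" "S23 * D4 = m * S34 * D2"
    "S14 * D2 = S24 * D1" "S14 * D3 = m * S34 * D1" "S24 * D3 = m * S34 * D2"
    using tri_relation[OF eq(1)] tri_relation[OF eq(2)] tri_relation[OF eq(3)] tri_relation[OF eq(4)]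
    unfolding Ds perm by (simp_all add: algebra_simps)
  have coords: "cmod z ^ 2 = Re z ^ 2 + Im z ^ 2" for z by (simp add: cmod_power2)
  \<comment> \<open>The alternating areas are the coefficients of the affine dependence between four
    points in the plane.\<close>
  have sumD: "D1 + D2 + D3 + D4 = 0"
    unfolding Ds tri_def by (simp add: algebra_simps)
  have sumDz: "D1 * Re z1 + D2 * Re z2 + D3 * Re z3 + D4 * Re z4 = 0"
      "D1 * Im z1 + D2 * Im z2 + D3 * Im z3 + D4 * Im z4 = 0"
    unfolding Ds tri_def by (simp, algebra)+
  \<comment> \<open>By the affine dependence, the weighted sum of squared distances to a point does
    not change with that point, so all four vortices give the same value \<open>E\<close>.\<close>
  define E where "E = D2 * R12 + D3 * R13 + D4 * R14"
  have E: "D2 * R12 + D3 * R13 + D4 * R14 = E" "D1 * R12 + D3 * R23 + D4 * R24 = E"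
    "D1 * R13 + D2 * R23 + D4 * R34 = E" "D1 * R14 + D2 * R24 + D3 * R34 = E"
    unfolding E_def Rs coords using sumD sumDz by (simp_all, algebra+)
  \<comment> \<open>If two areas vanish, the dependence involves only two distinct points, so its
    remaining coefficients vanish as well.\<close>
  have two: "D1 = 0 \<and> D2 = 0 \<and> D3 = 0 \<and> D4 = 0"
    if "D1 = 0 \<and> D2 = 0 \<or> D1 = 0 \<and> D3 = 0 \<or> D1 = 0 \<and> D4 = 0 \<or> D2 = 0 \<and> D3 = 0 \<or> D2 = 0 \<and> D4 = 0 \<or> D3 = 0 \<and> D4 = 0"
  proof -
    have *: "p = 0 \<and> q = 0" if "p + q = 0" "p * Re u + q * Re v = 0" "p * Im u + q * Im v = 0" "u \<noteq> v"
      for p q and u v :: complex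
    proof -
      have "q = - p" using that(1) by simp
      then have "p * (Re u - Re v) = 0" "p * (Im u - Im v) = 0" using that(2,3) by algebra+
      then show ?thesis using that(4) \<open>q = - p\<close> by (auto simp: complex_eq_iff)
    qed
    show ?thesis
      using that
    proof (elim disjE conjE)
      assume "D1 = 0" "D2 = 0"
      then show ?thesis using *[of D3 D4 z3 z4] sumD sumDz dist by simp
    next
      assume "D1 = 0" "D3 = 0"
      then show ?thesis using *[of D2 D4 z2 z4] sumD sumDz dist by simp
    next
      assume "D1 = 0" "D4 = 0"
      then show ?thesis using *[of D2 D3 z2 z3] sumD sumDz dist by simp
    next
      assume "D2 = 0" "D3 = 0"
      then show ?thesis using *[of D1 D4 z1 z4] sumD sumDz dist by simp
    next
      assume "D2 = 0" "D4 = 0"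
      then show ?thesis using *[of D1 D3 z1 z3] sumD sumDz dist by simp
    next
      assume "D3 = 0" "D4 = 0"
      then show ?thesis using *[of D1 D2 z1 z2] sumD sumDz dist by simp
    qed
  qed
  have noncol': "\<not> (D1 = 0 \<and> D2 = 0 \<and> D3 = 0 \<and> D4 = 0)" using noncol unfolding Ds by simp
  note two' = two noncol'
  have invL: "R = 1/L" if "1/R - L = 0" "R > 0" for R using that L by (simp add: field_simps)
  \<comment> \<open>If \<open>D4 = 0\<close>, the proportions make vortex 4 equidistant from the
    other three, with squared distance \<open>1/L\<close>. Then \<open>E\<close> is
    \<open>1/L\<close> times the sum of the areas, hence zero, and the other three sums contradict
    positivity. The remaining areas are treated alike.\<close>
  have D4: "D4 \<noteq> 0"
  proof
    assume 0: "D4 = 0"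
    then have nz: "D1 \<noteq> 0" "D2 \<noteq> 0" "D3 \<noteq> 0" using two' by blast+
    have Sz: "S14 = 0" "S24 = 0" "S34 = 0" using rel(2)[unfolded 0] rel(5)[unfolded 0] rel(8)[unfolded 0] nz m by simp_all
    have R: "R14 = 1/L" "R24 = 1/L" "R34 = 1/L" using Sz Rpos unfolding Ss by (blast intro: invL)+
    have "E = (D1 + D2 + D3) / L" using E(4) unfolding R by (simp add: add_divide_distrib)
    then have "E = 0" using sumD 0 by simp
    then show False
      using triangle_weights_contradiction[of R12 R13 R23 D1 D2 D3] Rpos nz E 0 by simp
  qed
  have D3: "D3 \<noteq> 0"
  proof
    assume 0: "D3 = 0"
    then have nz: "D1 \<noteq> 0" "D2 \<noteq> 0" "D4 \<noteq> 0" using two' by blast+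
    have Sz: "S13 = 0" "S23 = 0" "S34 = 0" using rel(1)[unfolded 0] rel(4)[unfolded 0] rel(11)[unfolded 0] nz m by simp_all
    have R: "R13 = 1/L" "R23 = 1/L" "R34 = 1/L" using Sz Rpos unfolding Ss by (blast intro: invL)+
    have "E = (D1 + D2 + D4) / L" using E(3) unfolding R by (simp add: add_divide_distrib)
    then have "E = 0" using sumD 0 by simp
    then show False
      using triangle_weights_contradiction[of R12 R14 R24 D1 D2 D4] Rpos nz E 0 by simp
  qed
  have D2: "D2 \<noteq> 0"
  proof
    assume 0: "D2 = 0"
    then have nz: "D1 \<noteq> 0" "D3 \<noteq> 0" "D4 \<noteq> 0" using two' by blast+
    have Sz: "S12 = 0" "S23 = 0" "S24 = 0" using rel(1)[unfolded 0] rel(7)[unfolded 0] rel(10)[unfolded 0] nz m by simp_all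
    have R: "R12 = 1/L" "R23 = 1/L" "R24 = 1/L" using Sz Rpos unfolding Ss by (blast intro: invL)+
    have "E = (D1 + D3 + D4) / L" using E(2) unfolding R by (simp add: add_divide_distrib)
    then have "E = 0" using sumD 0 by simp
    then show False
      using triangle_weights_contradiction[of R13 R14 R34 D1 D3 D4] Rpos nz E 0 by simp
  qed
  have D1: "D1 \<noteq> 0"
  proof
    assume 0: "D1 = 0"
    then have nz: "D2 \<noteq> 0" "D3 \<noteq> 0" "D4 \<noteq> 0" using two' by blast+
    have Sz: "S12 = 0" "S13 = 0" "S14 = 0" using rel(4)[unfolded 0] rel(7)[unfolded 0] rel(10)[unfolded 0] nz m by simp_all
    have R: "R12 = 1/L" "R13 = 1/L" "R14 = 1/L" using Sz Rpos unfolding Ss by (blast intro: invL)+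
    have "E = (D2 + D3 + D4) / L" using E(1) unfolding R by (simp add: add_divide_distrib)
    then have "E = 0" using sumD 0 by simp
    then show False
      using triangle_weights_contradiction[of R23 R24 R34 D2 D3 D4] Rpos nz E 0 by simp
  qed
  define x3 where "x3 = D3 / m"
  define x4 where "x4 = D4 / m"
  have x3: "D3 = m * x3" and x4: "D4 = m * x4" unfolding x3_def x4_def using m by auto
  have x34: "x3 \<noteq> 0" "x4 \<noteq> 0" using x3 x4 D3 D4 by auto
  \<comment> \<open>The constant of proportionality in the Dziobek relations; all six
    \<open>S\<close> are now expressed through it.\<close>
  define \<sigma> where "\<sigma> = S12 / (D1 * D2)"
  have S: "S12 = \<sigma> * D1 * D2" unfolding \<sigma>_def using D1 D2 by simp
  have S13: "S13 = \<sigma> * D1 * x3" using rel(1) D2 m unfolding x3 S by simp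
  have S14: "S14 = \<sigma> * D1 * x4" using rel(2) D2 m unfolding x4 S by simp
  have S23: "S23 = \<sigma> * D2 * x3" using rel(4) D1 m unfolding x3 S by simp
  have S24: "S24 = \<sigma> * D2 * x4" using rel(5) D1 m unfolding x4 S by simp
  have S34: "S34 = \<sigma> * x3 * x4" using rel(8) D1 m unfolding x4 S13 by simp
  define t where "t = \<sigma> / L"
  \<comment> \<open>Otherwise all six distances would agree, which is impossible for four points in
    the plane.\<close>
  have \<sigma>: "\<sigma> \<noteq> 0"
  proof
    assume "\<sigma> = 0"
    then have Sz: "S12 = 0" "S13 = 0" "S14 = 0" "S23 = 0" "S24 = 0" "S34 = 0" using S S13 S14 S23 S24 S34 by auto
    have R: "R12 = 1/L" "R13 = 1/L" "R14 = 1/L" "R23 = 1/L" "R24 = 1/L" "R34 = 1/L"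
      using Sz Rpos unfolding Ss by (blast intro: invL)+
    have "D2 + D3 + D4 = L * E" "D1 + D3 + D4 = L * E" "D1 + D2 + D4 = L * E" "D1 + D2 + D3 = L * E"
      using E unfolding R using L by (auto simp: field_simps)
    then have "D1 = 0" using sumD by linarith
    then show False using D1 by simp
  qed
  have r: "(L * R) * (1 + t * x * y) = 1" if "1/R - L = \<sigma> * x * y" "R > 0" for R x y
  proof -
    have "1 = R * (L + \<sigma> * x * y)" using that by (simp add: field_simps)
    also have "\<dots> = L * R * (1 + t * x * y)" unfolding t_def using L by (simp add: field_simps)
    finally show ?thesis by simp
  qed
  note r' = r[OF S[unfolded Ss] Rpos(1)] r[OF S13[unfolded Ss] Rpos(2)] r[OF S14[unfolded Ss] Rpos(3)]
    r[OF S23[unfolded Ss] Rpos(4)] r[OF S24[unfolded Ss] Rpos(5)] r[OF S34[unfolded Ss] Rpos(6)]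
  have LE: "D2 * (L * R12) + m * x3 * (L * R13) + m * x4 * (L * R14) = L * E"
     "D1 * (L * R12) + m * x3 * (L * R23) + m * x4 * (L * R24) = L * E"
     "D1 * (L * R13) + D2 * (L * R23) + m * x4 * (L * R34) = L * E"
     "D1 * (L * R14) + D2 * (L * R24) + m * x3 * (L * R34) = L * E"
    using arg_cong[OF E(1), of "\<lambda>s. L * s"] arg_cong[OF E(2), of "\<lambda>s. L * s"]
      arg_cong[OF E(3), of "\<lambda>s. L * s"] arg_cong[OF E(4), of "\<lambda>s. L * s"]
    unfolding x3 x4 by (simp_all add: algebra_simps)
  have lin: "D1 + D2 + m * (x3 + x4) = 0" using sumD unfolding x3 x4 by (simp add: algebra_simps)
  have same: "Ra = Rb" if "1/Ra - L = 1/Rb - L" "Ra > 0" "Rb > 0" for Ra Rb using that by simp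
  have "D1 \<noteq> D2"
  proof
    assume "D1 = D2"
    then have "S13 = S23" "S14 = S24" unfolding S13 S14 S23 S24 by simp_all
    then show False using asym1 same Rpos unfolding Ss by blast
  qed
  moreover have "x3 \<noteq> x4"
  proof
    assume "x3 = x4"
    then have "S13 = S14" "S23 = S24" unfolding S13 S14 S23 S24 by simp_all
    then show False using asym2 same Rpos unfolding Ss by blast
  qed
  \<comment> \<open>Vanishing would give \<open>D2 = - D1\<close> and equal cross distances, which
    is the trapezoid case.\<close>
  moreover have "x3 + x4 \<noteq> 0"
  proof
    assume c: "x3 + x4 = 0"
    then have "x4 = - x3" "D2 = - D1" using lin by auto
    then have "S13 = S24" "S14 = S23" unfolding S13 S14 S23 S24 by simp_all
    then have "R13 = R24" "R14 = R23" using same Rpos unfolding Ss by blast+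
    then show False using asym3 \<open>D2 = - D1\<close> unfolding Ds by simp
  qed
  ultimately have "t * D1 * D2 = m"
    using dziobek_product[OF m _ D1 D2 x34 lin r' LE] \<sigma> L unfolding t_def by simp
  then show ?thesis using r'(1) by simp
qed

section \<open>The equations in complex form\<close>

text \<open>The rotation term joins the sum because the total circulation times \<open>z $ i\<close>
  minus the center is the circulation-weighted sum of the differences \<open>z $ i - z $ j\<close>.
  The term for \<open>j = i\<close> contributes zero. Dividing by a nonzero
  \<open>\<Gamma> $ i\<close> gives the same formula as the convention for zero circulation.\<close>

lemma vortex_equation_iff:
  assumes "(\<Sum>i\<in>UNIV. \<Gamma> $ i) \<noteq> 0"
  shows "vortex_equation \<Gamma> \<omega> z i \<longleftrightarrow>
    (\<Sum>j\<in>UNIV. (\<Gamma> $ j * (1 / (dist (z $ i) (z $ j))\<^sup>2 - \<omega> / (\<Sum>i\<in>UNIV. \<Gamma> $ i))) *\<^sub>R (z $ j - z $ i)) = 0"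
proof -
  define G where "G = (\<Sum>i\<in>UNIV. \<Gamma> $ i)"
  have G: "G \<noteq> 0" using assms by (simp add: G_def)
  define A where "A = (\<Sum>j\<in>UNIV - {i}. (\<Gamma> $ j / (dist (z $ i) (z $ j))\<^sup>2) *\<^sub>R (z $ j - z $ i))"
  have A: "A = (\<Sum>j\<in>UNIV. (\<Gamma> $ j / (dist (z $ i) (z $ j))\<^sup>2) *\<^sub>R (z $ j - z $ i))"
    unfolding A_def by (rule sum.mono_neutral_left) auto
  have "(\<Sum>j\<in>UNIV. \<Gamma> $ j *\<^sub>R (z $ j - z $ i)) = (\<Sum>j\<in>UNIV. \<Gamma> $ j *\<^sub>R z $ j) - G *\<^sub>R z $ i"
    by (simp add: scaleR_right_diff_distrib sum_subtractf scaleR_sum_left G_def)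
  also have "(\<Sum>j\<in>UNIV. \<Gamma> $ j *\<^sub>R z $ j) = G *\<^sub>R center_of_vorticity \<Gamma> z"
    unfolding center_of_vorticity_def G_def[symmetric] using G by simp
  finally have sum: "(\<Sum>j\<in>UNIV. \<Gamma> $ j *\<^sub>R (z $ j - z $ i)) = G *\<^sub>R center_of_vorticity \<Gamma> z - G *\<^sub>R z $ i" .
  have C: "\<omega> *\<^sub>R (z $ i - center_of_vorticity \<Gamma> z) = - (\<omega> / G) *\<^sub>R (\<Sum>j\<in>UNIV. \<Gamma> $ j *\<^sub>R (z $ j - z $ i))"
    unfolding sum using G by (simp add: algebra_simps)
  have "A + \<omega> *\<^sub>R (z $ i - center_of_vorticity \<Gamma> z) =
    (\<Sum>j\<in>UNIV. (\<Gamma> $ j * (1 / (dist (z $ i) (z $ j))\<^sup>2 - \<omega> / G)) *\<^sub>R (z $ j - z $ i))"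
    unfolding A C scaleR_sum_right sum.distrib[symmetric] by (rule sum.cong) (simp_all add: algebra_simps)
  moreover have "vortex_equation \<Gamma> \<omega> z i \<longleftrightarrow> A + \<omega> *\<^sub>R (z $ i - center_of_vorticity \<Gamma> z) = 0"
  proof (cases "\<Gamma> $ i = 0")
    case True
    then show ?thesis by (simp add: vortex_equation_def A_def)
  next
    case False
    have "(\<Sum>j\<in>UNIV - {i}. (\<Gamma> $ i * \<Gamma> $ j / (dist (z $ i) (z $ j))\<^sup>2) *\<^sub>R (z $ j - z $ i)) = \<Gamma> $ i *\<^sub>R A"
      unfolding A_def scaleR_sum_right by (rule sum.cong) simp_all
    then have "vortex_equation \<Gamma> \<omega> z i \<longleftrightarrow> \<Gamma> $ i *\<^sub>R (A + \<omega> *\<^sub>R (z $ i - center_of_vorticity \<Gamma> z)) = 0"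
      using False by (simp add: vortex_equation_def scaleR_right_distrib mult.commute)
    then show ?thesis using False by simp
  qed
  ultimately show ?thesis by (simp add: G_def)
qed

section \<open>The equilibrium equations in the complex plane\<close>

definition cpx :: "real^2 \<Rightarrow> complex" where
  "cpx v = Complex (v $ 1) (v $ 2)"

lemma cpx_simps [simp]:
  "cpx (v + w) = cpx v + cpx w" "cpx (v - w) = cpx v - cpx w" "cpx (c *\<^sub>R v) = c *\<^sub>R cpx v"
  "cpx 0 = 0" "cpx (- v) = - cpx v" "Re (cpx v) = v $ 1" "Im (cpx v) = v $ 2"
  by (simp_all add: cpx_def complex_eq_iff)

lemma cpx_eq_iff: "cpx v = cpx w \<longleftrightarrow> v = w"
  by (auto simp: cpx_def vec_eq_iff forall_2)

lemma cpx_eq_0_iff: "cpx v = 0 \<longleftrightarrow> v = 0"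
  using cpx_eq_iff[of v 0] by simp

lemma cmod_cpx: "cmod (cpx v) = norm v"
  by (simp add: cmod_def norm_vec_def L2_set_def sum_2)

lemma dist_cpx: "dist v w = cmod (cpx v - cpx w)"
  using cmod_cpx[of "v - w"] by (simp add: dist_norm)

lemma vector_4:
  fixes x y z w :: "'a::zero"
  shows "(vector [x, y, z, w] :: 'a^4) $ 1 = x" "(vector [x, y, z, w] :: 'a^4) $ 2 = y"
    "(vector [x, y, z, w] :: 'a^4) $ 3 = z" "(vector [x, y, z, w] :: 'a^4) $ 4 = w"
  by (simp_all add: vector_def)

lemma sum_circulations: "(\<Sum>i\<in>UNIV. circulations m $ i) = 2 + 2 * m"
  by (simp add: circulations_def sum_4 vector_4)

lemma circulations_nth [simp]: "circulations m $ 1 = 1" "circulations m $ 2 = 1"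
  "circulations m $ 3 = m" "circulations m $ 4 = m"
  by (simp_all add: circulations_def vector_4)

text \<open>\<open>- 1 < m\<close> keeps the total circulation \<open>2 + 2 * m\<close> away from
  zero. Distances are written with the smaller index first, matching the form used in
  \<open>asymmetric_omega\<close>.\<close>

lemma relative_equilibrium_with_iff:
  fixes z :: "real^2^4" and \<omega> m :: real
  assumes "- 1 < m"
  defines "z1 \<equiv> cpx (z $ 1)" and "z2 \<equiv> cpx (z $ 2)" and "z3 \<equiv> cpx (z $ 3)" and "z4 \<equiv> cpx (z $ 4)"
  defines "L \<equiv> \<omega> / (2 + 2 * m)"
  shows "relative_equilibrium_with (circulations m) \<omega> z \<longleftrightarrow> \<omega> \<noteq> 0 \<and>
    (z1 \<noteq> z2 \<and> z1 \<noteq> z3 \<and> z1 \<noteq> z4 \<and> z2 \<noteq> z3 \<and> z2 \<noteq> z4 \<and> z3 \<noteq> z4) \<and>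
    (1 / (cmod (z1 - z2))\<^sup>2 - L) *\<^sub>R (z2 - z1) + (m * (1 / (cmod (z1 - z3))\<^sup>2 - L)) *\<^sub>R (z3 - z1) + (m * (1 / (cmod (z1 - z4))\<^sup>2 - L)) *\<^sub>R (z4 - z1) = 0 \<and>
    (1 / (cmod (z1 - z2))\<^sup>2 - L) *\<^sub>R (z1 - z2) + (m * (1 / (cmod (z2 - z3))\<^sup>2 - L)) *\<^sub>R (z3 - z2) + (m * (1 / (cmod (z2 - z4))\<^sup>2 - L)) *\<^sub>R (z4 - z2) = 0 \<and>
    (1 / (cmod (z1 - z3))\<^sup>2 - L) *\<^sub>R (z1 - z3) + (1 / (cmod (z2 - z3))\<^sup>2 - L) *\<^sub>R (z2 - z3) + (m * (1 / (cmod (z3 - z4))\<^sup>2 - L)) *\<^sub>R (z4 - z3) = 0 \<and>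
    (1 / (cmod (z1 - z4))\<^sup>2 - L) *\<^sub>R (z1 - z4) + (1 / (cmod (z2 - z4))\<^sup>2 - L) *\<^sub>R (z2 - z4) + (m * (1 / (cmod (z3 - z4))\<^sup>2 - L)) *\<^sub>R (z3 - z4) = 0"
proof -
  have nz: "(\<Sum>i\<in>UNIV. circulations m $ i) \<noteq> 0" using assms(1) by (simp add: sum_circulations)
  have cf: "collision_free z \<longleftrightarrow> z1 \<noteq> z2 \<and> z1 \<noteq> z3 \<and> z1 \<noteq> z4 \<and> z2 \<noteq> z3 \<and> z2 \<noteq> z4 \<and> z3 \<noteq> z4"
    unfolding collision_free_def forall_4 z1_def z2_def z3_def z4_def cpx_eq_iff by auto
  have ve: "vortex_equation (circulations m) \<omega> z i \<longleftrightarrow>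
     (1 / (cmod (cpx (z $ i) - z1))\<^sup>2 - L) *\<^sub>R (z1 - cpx (z $ i)) + (1 / (cmod (cpx (z $ i) - z2))\<^sup>2 - L) *\<^sub>R (z2 - cpx (z $ i))
    + (m * (1 / (cmod (cpx (z $ i) - z3))\<^sup>2 - L)) *\<^sub>R (z3 - cpx (z $ i)) + (m * (1 / (cmod (cpx (z $ i) - z4))\<^sup>2 - L)) *\<^sub>R (z4 - cpx (z $ i)) = 0" for i
    unfolding vortex_equation_iff[OF nz] sum_circulations L_def[symmetric] z1_def z2_def z3_def z4_def
    by (subst cpx_eq_0_iff[symmetric]) (simp add: sum_4 dist_cpx)
  show ?thesis
    unfolding relative_equilibrium_with_def cf forall_4 ve z1_def[symmetric] z2_def[symmetric] z3_def[symmetric] z4_def[symmetric]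
    by (simp add: norm_minus_commute[of z2 z1] norm_minus_commute[of z3 z1] norm_minus_commute[of z4 z1]
      norm_minus_commute[of z3 z2] norm_minus_commute[of z4 z2] norm_minus_commute[of z4 z3])
qed

text \<open>A squared modulus is a number times its conjugate, so conjugation turns the
  inverse-square force into a reciprocal, which is accessible to rational algebra.\<close>

lemma cnj_force:
  assumes "z \<noteq> w"
  shows "cnj ((p * (1 / (cmod (w - z))\<^sup>2 - L)) *\<^sub>R (z - w)) = of_real p * (1 / (z - w) - of_real L * cnj (z - w))"
    "cnj ((p * (1 / (cmod (z - w))\<^sup>2 - L)) *\<^sub>R (z - w)) = of_real p * (1 / (z - w) - of_real L * cnj (z - w))"
proof -
  have "1 / (z - w) = cnj (z - w) / of_real ((cmod (z - w))\<^sup>2)"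
    by (simp add: complex_div_cnj[of 1])
  then show "cnj ((p * (1 / (cmod (z - w))\<^sup>2 - L)) *\<^sub>R (z - w)) = of_real p * (1 / (z - w) - of_real L * cnj (z - w))"
    by (simp add: scaleR_conv_of_real algebra_simps)
  then show "cnj ((p * (1 / (cmod (w - z))\<^sup>2 - L)) *\<^sub>R (z - w)) = of_real p * (1 / (z - w) - of_real L * cnj (z - w))"
    by (simp add: norm_minus_commute)
qed

text \<open>Sums and differences of the equations within the pairs 1, 2 and 3, 4 bring everything
  into terms of \<open>u\<^sup>2 - 1\<close> and \<open>v\<^sup>2 - 1\<close>. The sum for the first
  pair is, up to a factor, \<open>m\<close> times the sum for the second, so three complex equations
  remain.\<close>

lemma normalized_equilibrium_iff:
  fixes z :: "real^2^4" and \<omega> m :: real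
  assumes m: "- 1 < m" and z: "cpx (z $ 1) = 1" "cpx (z $ 2) = - 1" "cpx (z $ 3) = u" "cpx (z $ 4) = v"
  defines "L \<equiv> \<omega> / (2 + 2 * m)"
  shows "relative_equilibrium_with (circulations m) \<omega> z \<longleftrightarrow> \<omega> \<noteq> 0 \<and>
    (u\<^sup>2 \<noteq> 1 \<and> v\<^sup>2 \<noteq> 1 \<and> u \<noteq> v) \<and>
    of_real (4 * L * (1 + m) - 1) + 2 * of_real m * (1 / (u\<^sup>2 - 1) + 1 / (v\<^sup>2 - 1)) = 0 \<and>
    u / (u\<^sup>2 - 1) + v / (v\<^sup>2 - 1) - of_real L * cnj (u + v) = 0 \<and>
    u / (u\<^sup>2 - 1) - v / (v\<^sup>2 - 1) + of_real m / (u - v) - of_real (L * (1 + m)) * cnj (u - v) = 0"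
proof (cases "u\<^sup>2 \<noteq> 1 \<and> v\<^sup>2 \<noteq> 1 \<and> u \<noteq> v")
  case False
  then show ?thesis
    unfolding relative_equilibrium_with_iff[OF m] z by (auto simp: power2_eq_1_iff)
next
  case True
  then have ne: "u \<noteq> 1" "u \<noteq> - 1" "v \<noteq> 1" "v \<noteq> - 1" "u \<noteq> v" by auto
  then have ne': "1 \<noteq> u" "- 1 \<noteq> u" "1 \<noteq> v" "-1 \<noteq> v" "v \<noteq> u" by auto
  define k where "k = complex_of_real m"
  define l where "l = complex_of_real L"
  define a where "a = 1 / (u - 1)"
  define a' where "a' = 1 / (u + 1)"
  define b where "b = 1 / (v - 1)"
  define b' where "b' = 1 / (v + 1)"
  define q where "q = 1 / (u - v)"
  define cu where "cu = cnj u"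
  define cv where "cv = cnj v"
  have s: "x = 0 \<longleftrightarrow> cnj x = 0" for x by simp
  have U: "u\<^sup>2 - 1 = (u - 1) * (u + 1)" "v\<^sup>2 - 1 = (v - 1) * (v + 1)" by algebra+
  have un: "u - 1 \<noteq> 0" "u + 1 \<noteq> 0" "v - 1 \<noteq> 0" "v + 1 \<noteq> 0" using ne by (auto simp: eq_neg_iff_add_eq_0)
  \<comment> \<open>Partial fractions relate the individual forces of vortices 1 and 2 to the
    combined terms in the statement.\<close>
  have 1: "2 / (u\<^sup>2 - 1) = a - a'" "2 / (v\<^sup>2 - 1) = b - b'"
    "u / (u\<^sup>2 - 1) = (a + a') / 2" "v / (v\<^sup>2 - 1) = (b + b') / 2"
    unfolding U a_def a'_def b_def b'_def using un by (simp_all add: divide_simps)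
  have e1: "(1 / (cmod (1 - (- 1)))\<^sup>2 - L) *\<^sub>R (- 1 - 1) + (m * (1 / (cmod (1 - u))\<^sup>2 - L)) *\<^sub>R (u - 1) + (m * (1 / (cmod (1 - v))\<^sup>2 - L)) *\<^sub>R (v - 1) = 0
    \<longleftrightarrow> - 1/2 + 2 * l + k * (a - l * (cu - 1)) + k * (b - l * (cv - 1)) = 0"
    (is "?x + ?y + ?z = 0 \<longleftrightarrow> _")
    unfolding s[of "?x + ?y + ?z"] complex_cnj_add cnj_force(1)[OF ne(1)] cnj_force(1)[OF ne(3)]
    unfolding k_def[symmetric] l_def[symmetric] a_def b_def cu_def cv_def
    by (simp add: scaleR_conv_of_real l_def algebra_simps)
  have e2: "(1 / (cmod (1 - (- 1)))\<^sup>2 - L) *\<^sub>R (1 - (- 1)) + (m * (1 / (cmod (- 1 - u))\<^sup>2 - L)) *\<^sub>R (u - (- 1)) + (m * (1 / (cmod (- 1 - v))\<^sup>2 - L)) *\<^sub>R (v - (- 1)) = 0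
    \<longleftrightarrow> 1/2 - 2 * l + k * (a' - l * (cu + 1)) + k * (b' - l * (cv + 1)) = 0"
    (is "?x + ?y + ?z = 0 \<longleftrightarrow> _")
    unfolding s[of "?x + ?y + ?z"] complex_cnj_add cnj_force(1)[OF ne(2)] cnj_force(1)[OF ne(4)]
    unfolding k_def[symmetric] l_def[symmetric] a'_def b'_def cu_def cv_def
    by (simp add: scaleR_conv_of_real l_def algebra_simps)
  have e3: "(1 / (cmod (1 - u))\<^sup>2 - L) *\<^sub>R (1 - u) + (1 / (cmod (- 1 - u))\<^sup>2 - L) *\<^sub>R (- 1 - u) + (m * (1 / (cmod (u - v))\<^sup>2 - L)) *\<^sub>R (v - u) = 0
    \<longleftrightarrow> (- a - l * (1 - cu)) + (- a' - l * (- 1 - cu)) + k * (- q - l * (cv - cu)) = 0"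
    (is "?x + ?y + ?z = 0 \<longleftrightarrow> _")
  proof -
    have "1 / (1 - u) = - a" "1 / (- 1 - u) = - a'" "1 / (v - u) = - q" 
      unfolding a_def a'_def q_def using ne un by (simp_all add: divide_simps) 
    then show ?thesis
      unfolding s[of "?x + ?y + ?z"] complex_cnj_add cnj_force(2)[OF ne'(1), of 1, unfolded mult_1] 
        cnj_force(2)[OF ne'(2), of 1, unfolded mult_1] cnj_force(1)[OF ne'(5)]
      by (simp add: k_def l_def cu_def cv_def)
  qed
  have e4: "(1 / (cmod (1 - v))\<^sup>2 - L) *\<^sub>R (1 - v) + (1 / (cmod (- 1 - v))\<^sup>2 - L) *\<^sub>R (- 1 - v) + (m * (1 / (cmod (u - v))\<^sup>2 - L)) *\<^sub>R (u - v) = 0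
    \<longleftrightarrow> (- b - l * (1 - cv)) + (- b' - l * (- 1 - cv)) + k * (q - l * (cu - cv)) = 0"
    (is "?x + ?y + ?z = 0 \<longleftrightarrow> _")
  proof -
    have "1 / (1 - v) = - b" "1 / (- 1 - v) = - b'" "1 / (u - v) = q" 
      unfolding b_def b'_def q_def using ne un by (simp_all add: divide_simps) 
    then show ?thesis
      unfolding s[of "?x + ?y + ?z"] complex_cnj_add cnj_force(2)[OF ne'(3), of 1, unfolded mult_1] 
        cnj_force(2)[OF ne'(4), of 1, unfolded mult_1] cnj_force(2)[OF ne(5)]
      by (simp add: k_def l_def cu_def cv_def)
  qed
  have r1: "of_real (4 * L * (1 + m) - 1) + 2 * of_real m * (1 / (u\<^sup>2 - 1) + 1 / (v\<^sup>2 - 1)) = 4 * l * (1 + k) - 1 + k * ((a - a') + (b - b'))"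
    unfolding 1(1,2)[symmetric] k_def l_def by (simp add: algebra_simps)
  have r2: "u / (u\<^sup>2 - 1) + v / (v\<^sup>2 - 1) - of_real L * cnj (u + v) = ((a + a') + (b + b')) / 2 - l * (cu + cv)"
    unfolding 1(3,4) k_def l_def cu_def cv_def by (simp add: add_divide_distrib)
  have r3: "u / (u\<^sup>2 - 1) - v / (v\<^sup>2 - 1) + of_real m / (u - v) - of_real (L * (1 + m)) * cnj (u - v)
     = ((a + a') - (b + b')) / 2 + k * q - l * (1 + k) * (cu - cv)"
    unfolding 1(3,4) k_def l_def cu_def cv_def q_def by (simp add: diff_divide_distrib)
  have f1: "- 1/2 + 2 * l + k * (a - l * (cu - 1)) + k * (b - l * (cv - 1)) = 0 \<and> 1/2 - 2 * l + k * (a' - l * (cu + 1)) + k * (b' - l * (cv + 1)) = 0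
    \<longleftrightarrow> 4 * l * (1 + k) - 1 + k * ((a - a') + (b - b')) = 0 \<and> k * (((a + a') + (b + b')) / 2 - l * (cu + cv)) = 0"
    by (auto; algebra)
  have f2: "(- a - l * (1 - cu)) + (- a' - l * (- 1 - cu)) + k * (- q - l * (cv - cu)) = 0 \<and> (- b - l * (1 - cv)) + (- b' - l * (- 1 - cv)) + k * (q - l * (cu - cv)) = 0
    \<longleftrightarrow> ((a + a') + (b + b')) / 2 - l * (cu + cv) = 0 \<and> ((a + a') - (b + b')) / 2 + k * q - l * (1 + k) * (cu - cv) = 0"
    by (auto; algebra)
  have "1 \<noteq> (-1::complex)" by simp
  moreover have "k * (((a + a') + (b + b')) / 2 - l * (cu + cv)) = 0" if "((a + a') + (b + b')) / 2 - l * (cu + cv) = 0"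
    using that by simp
  ultimately show ?thesis
    unfolding relative_equilibrium_with_iff[OF m] z L_def[symmetric]
    unfolding e1 e2 e3 e4 r1 r2 r3
    using f1 f2 True ne' by blast
qed

section \<open>Mirror axes and the angular velocity of normalized equilibria\<close>

lemma range_nth_4: "range (($) (z :: 'a^4)) = {z $ 1, z $ 2, z $ 3, z $ 4}"
  by (simp add: UNIV_4)

lemma reflect_bisector:
  assumes "dist x a = dist x b"
  shows "reflect_in_line (midpoint a b) (a - b) x = x"
proof -
  have "(a - b) \<bullet> (x - midpoint a b) = ((dist x b)\<^sup>2 - (dist x a)\<^sup>2) / 2"
    unfolding midpoint_def dist_norm power2_norm_eq_inner
    by (simp add: algebra_simps inner_commute)
  then show ?thesis using assms by (simp add: reflect_in_line_def)
qed

lemma reflect_bisector_swap: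
  assumes "a \<noteq> b"
  shows "reflect_in_line (midpoint a b) (a - b) a = b" "reflect_in_line (midpoint a b) (a - b) b = a"
proof -
  have 1: "(a - b) \<bullet> (a - midpoint a b) = ((a - b) \<bullet> (a - b)) / 2" "(a - b) \<bullet> (b - midpoint a b) = - ((a - b) \<bullet> (a - b)) / 2"
    unfolding midpoint_def by (simp_all add: algebra_simps inner_commute)
  have "(a - b) \<bullet> (a - b) \<noteq> 0" using assms by simp
  then show "reflect_in_line (midpoint a b) (a - b) a = b" "reflect_in_line (midpoint a b) (a - b) b = a"
    unfolding reflect_in_line_def 1 by simp_all
qed

text \<open>The perpendicular bisector of \<open>a\<close> and \<open>b\<close> swaps these two
  points and fixes the others pointwise.\<close>

lemma bisector_imp_symmetry_axis:
  fixes z :: "real^2^4"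
  assumes ab: "a \<noteq> b" and eq: "\<And>x. x \<in> S \<Longrightarrow> dist x a = dist x b" and S: "range (($) z) = insert a (insert b S)"
  shows "has_symmetry_axis z"
proof -
  have "reflect_in_line (midpoint a b) (a - b) ` S = S"
    using reflect_bisector[OF eq] by force
  then show ?thesis
    unfolding has_symmetry_axis_def S using ab
    by (intro exI[of _ "midpoint a b"] exI[of _ "a - b"]) (simp add: reflect_bisector_swap insert_commute)
qed

lemma collinear_if_snd_zero:
  fixes S :: "(real^2) set"
  assumes "\<And>x. x \<in> S \<Longrightarrow> x $ 2 = 0"
  shows "collinear S"
  unfolding collinear_def
proof (rule exI[of _ "axis 1 1"], intro ballI)
  fix x y assume "x \<in> S" "y \<in> S"
  then show "\<exists>c. x - y = c *\<^sub>R (axis 1 1 :: real^2)"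
    using assms by (intro exI[of _ "x $ 1 - y $ 1"]) (simp add: vec_eq_iff forall_2 axis_def)
qed

text \<open>For nonzero \<open>m\<close>, \<open>asymmetric_omega\<close> with squared distance 4
  between vortices 1 and 2 gives the angular velocity; the first normalized equation then reduces to
  the relation for the squares. At \<open>m = 0\<close> the equations for \<open>u\<close> and
  \<open>v\<close> decouple.\<close>

lemma asymmetric_equilibrium:
  fixes z :: "real^2^4" and \<omega> m :: real
  assumes m: "- 1 < m" "m < 1" and z: "cpx (z $ 1) = 1" "cpx (z $ 2) = - 1" "cpx (z $ 3) = u" "cpx (z $ 4) = v"
    and re: "relative_equilibrium_with (circulations m) \<omega> z" and asym: "asymmetric z"
  shows "\<omega> = 1/2" "u\<^sup>2 + v\<^sup>2 = 2"
proof -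
  define L where "L = \<omega> / (2 + 2 * m)"
  have coords: "z $ 1 $ 1 = 1" "z $ 1 $ 2 = 0" "z $ 2 $ 1 = - 1" "z $ 2 $ 2 = 0"
    "z $ 3 $ 1 = Re u" "z $ 3 $ 2 = Im u" "z $ 4 $ 1 = Re v" "z $ 4 $ 2 = Im v"
    using z by (auto simp: complex_eq_iff)
  have noncol: "\<not> (Im u = 0 \<and> Im v = 0)"
  proof
    assume "Im u = 0 \<and> Im v = 0"
    then have "collinear (range (($) z))"
      unfolding range_nth_4 by (intro collinear_if_snd_zero) (auto simp: coords)
    then show False using asym by (simp add: asymmetric_def)
  qed
  have noaxis: "\<not> has_symmetry_axis z" using asym by (simp add: asymmetric_def)
  have ne: "u \<noteq> 1" "u \<noteq> - 1" "v \<noteq> 1" "v \<noteq> - 1" "u \<noteq> v" "u\<^sup>2 \<noteq> 1" "v\<^sup>2 \<noteq> 1"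
    using re unfolding normalized_equilibrium_iff[OF m(1) z] by auto
  have zne: "z $ 1 \<noteq> z $ 2" "z $ 3 \<noteq> z $ 4" using z ne(5) by (auto simp: cpx_eq_iff[symmetric])
  have asym1: "\<not> (cmod (1 - u) = cmod (- 1 - u) \<and> cmod (1 - v) = cmod (- 1 - v))"
  proof
    assume "cmod (1 - u) = cmod (- 1 - u) \<and> cmod (1 - v) = cmod (- 1 - v)"
    then have "has_symmetry_axis z"
      using zne(1) by (intro bisector_imp_symmetry_axis[of "z $ 1" "z $ 2" "{z $ 3, z $ 4}"])
        (auto simp: dist_cpx z norm_minus_commute range_nth_4)
    then show False using noaxis by simp
  qed
  have asym2: "\<not> (cmod (1 - u) = cmod (1 - v) \<and> cmod (- 1 - u) = cmod (- 1 - v))"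
  proof
    assume "cmod (1 - u) = cmod (1 - v) \<and> cmod (- 1 - u) = cmod (- 1 - v)"
    then have "has_symmetry_axis z"
      using zne(2) by (intro bisector_imp_symmetry_axis[of "z $ 3" "z $ 4" "{z $ 1, z $ 2}"])
        (auto simp: dist_cpx z range_nth_4)
    then show False using noaxis by simp
  qed
  \<comment> \<open>Equal areas put \<open>u\<close> and \<open>v\<close> at the same height, and
    the distances then make their real parts opposite, so reflection in the imaginary axis swaps
    both pairs.\<close>
  have asym3: "\<not> (tri (- 1) u v = tri 1 u v \<and> (cmod (1 - u))\<^sup>2 = (cmod (- 1 - v))\<^sup>2 \<and> (cmod (1 - v))\<^sup>2 = (cmod (- 1 - u))\<^sup>2)"
  proof
    assume a: "tri (- 1) u v = tri 1 u v \<and> (cmod (1 - u))\<^sup>2 = (cmod (- 1 - v))\<^sup>2 \<and> (cmod (1 - v))\<^sup>2 = (cmod (- 1 - u))\<^sup>2"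
    then have "Im u = Im v" by (simp add: tri_def algebra_simps)
    moreover have "Re v = - Re u" using a \<open>Im u = Im v\<close> unfolding cmod_power2 by (simp add: power2_eq_square algebra_simps)
    ultimately have "reflect_in_line 0 (axis 1 1) (z $ 3) = z $ 4" "reflect_in_line 0 (axis 1 1) (z $ 4) = z $ 3"
      "reflect_in_line 0 (axis 1 1) (z $ 1) = z $ 2" "reflect_in_line 0 (axis 1 1) (z $ 2) = z $ 1"
      by (simp_all add: reflect_in_line_def vec_eq_iff forall_2 inner_axis' coords) (simp_all add: axis_def)
    then have "reflect_in_line 0 (axis 1 1) ` range (($) z) = range (($) z)"
      unfolding range_nth_4 by auto
    moreover have "axis 1 1 \<noteq> (0::real^2)" by simp
    ultimately show False using noaxis unfolding has_symmetry_axis_def by blast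
  qed
  have \<omega>0: "\<omega> \<noteq> 0" using re by (simp add: relative_equilibrium_with_def)
  then have L: "L \<noteq> 0" using m by (simp add: L_def)
  note eqs = normalized_equilibrium_iff[OF m(1) z, THEN iffD1, OF re, folded L_def]
  have "\<omega> = 1/2 \<and> u\<^sup>2 + v\<^sup>2 = 2"
  proof (cases "m = 0")
    case False
    have sq: "(x\<^sup>2 = y\<^sup>2) = (x = y)" if "x \<ge> 0" "y \<ge> 0" for x y :: real using that by (simp add: power2_eq_iff_nonneg)
    have "L * (cmod (1 - (- 1)))\<^sup>2 * (1 + m) = 1"
    proof (rule asymmetric_omega[OF m False L])
      show "\<not> (tri (- 1) u v = 0 \<and> tri 1 u v = 0 \<and> tri 1 (- 1) v = 0 \<and> tri 1 (- 1) u = 0)"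
        using noncol by (auto simp: tri_def)
    qed (use re[unfolded relative_equilibrium_with_iff[OF m(1)] z, folded L_def] asym1 asym2 asym3 in
        \<open>auto simp: sq\<close>)
    then have Lm: "L * (1 + m) = 1/4" by simp
    moreover have "L * (1 + m) = \<omega> / 2" unfolding L_def using m by (simp add: field_simps)
    ultimately have \<omega>: "\<omega> = 1/2" by simp
    have r: "4 * L * (1 + m) - 1 = 0" using Lm by simp
    have "1 / (u\<^sup>2 - 1) + 1 / (v\<^sup>2 - 1) = 0" using eqs[unfolded r] False by simp
    then have "u\<^sup>2 + v\<^sup>2 = 2" using ne(6,7) by (simp add: divide_simps add_eq_0_iff2 add.commute)
    then show ?thesis using \<omega> by simp
  next
    case True
    then have L4: "L = 1/4" using eqs by (simp add: complex_eq_iff)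
    then have \<omega>: "\<omega> = 1/2" using True unfolding L_def by simp
    have e: "u / (u\<^sup>2 - 1) = cnj u / 4" "v / (v\<^sup>2 - 1) = cnj v / 4"
    proof -
      have *: "x = a / 4 \<and> y = b / 4" if "x + y - (a + b) / 4 = 0" "x - y - (a - b) / 4 = 0" for x y a b :: complex
        using that by (simp, algebra)
      have "u / (u\<^sup>2 - 1) + v / (v\<^sup>2 - 1) - (cnj u + cnj v) / 4 = 0" "u / (u\<^sup>2 - 1) - v / (v\<^sup>2 - 1) - (cnj u - cnj v) / 4 = 0"
        using eqs unfolding True L4 by simp_all
      from *[OF this] show "u / (u\<^sup>2 - 1) = cnj u / 4" "v / (v\<^sup>2 - 1) = cnj v / 4" by auto
    qed
    \<comment> \<open>Clearing the denominator gives \<open>4 * w = cnj w * (w\<^sup>2 - 1)\<close>,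
      whose real and imaginary parts factor. The only points allowed are 0, two real ones with
      square 5 and two imaginary ones with square -3. Noncollinearity and the absence of an axis
      leave one point of each of the last two kinds.\<close>
    have c: "(Re w = 0 \<or> (Re w)\<^sup>2 + (Im w)\<^sup>2 = 5) \<and> (Im w = 0 \<or> (Re w)\<^sup>2 + (Im w)\<^sup>2 = 3)"
      if "w / (w\<^sup>2 - 1) = cnj w / 4" "w\<^sup>2 \<noteq> 1" for w
    proof -
      have "4 * w = cnj w * (w\<^sup>2 - 1)" using that by (simp add: field_simps)
      then have "Re w * ((Re w)\<^sup>2 + (Im w)\<^sup>2 - 5) = 0" "Im w * ((Re w)\<^sup>2 + (Im w)\<^sup>2 - 3) = 0"
        by (simp_all add: complex_eq_iff power2_eq_square algebra_simps)
      then show ?thesis by auto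
    qed
    have nim: "\<not> (Re u = 0 \<and> Re v = 0)"
      using asym1 by (auto simp: cmod_def)
    have "(Re u)\<^sup>2 = 5 \<and> Im u = 0 \<and> Re v = 0 \<and> (Im v)\<^sup>2 = 3 \<or> (Re v)\<^sup>2 = 5 \<and> Im v = 0 \<and> Re u = 0 \<and> (Im u)\<^sup>2 = 3"
      using c[OF e(1) ne(6)] c[OF e(2) ne(7)] noncol nim by auto
    then have "u\<^sup>2 + v\<^sup>2 = 2" by (auto simp: complex_eq_iff power2_eq_square)
    then show ?thesis using \<omega> by simp
  qed
  then show "\<omega> = 1/2" "u\<^sup>2 + v\<^sup>2 = 2" by auto
qed

text \<open>With \<open>u\<^sup>2 + v\<^sup>2 = 2\<close> the product of \<open>u + v\<close> and
  \<open>u - v\<close> is \<open>2 * (u\<^sup>2 - 1)\<close>. The two remaining equations thus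
  equate a multiple of the reciprocal of \<open>u + v\<close> or \<open>u - v\<close> with a
  multiple of its conjugate, which only prescribes the modulus.\<close>

lemma normalized_equilibrium_half_iff:
  fixes z :: "real^2^4" and m :: real
  assumes m: "- 1 < m" and z: "cpx (z $ 1) = 1" "cpx (z $ 2) = - 1" "cpx (z $ 3) = u" "cpx (z $ 4) = v"
    and uv: "u\<^sup>2 + v\<^sup>2 = 2"
  shows "relative_equilibrium_with (circulations m) (1/2) z \<longleftrightarrow> (cmod (u + v))\<^sup>2 = 8 * (1 + m) \<and> (cmod (u - v))\<^sup>2 = 8 + 4 * m"
proof -
  define k where "k = complex_of_real m"
  have k: "1 + k \<noteq> 0" unfolding k_def using m by (simp add: complex_eq_iff)
  have L: "4 * (1 / 2 / (2 + 2 * m)) * (1 + m) - 1 = (0::real)" using m by (simp add: field_simps)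
  have L2: "complex_of_real (1 / 2 / (2 + 2 * m) * (1 + m)) = 1/4" "complex_of_real (1 / 2 / (2 + 2 * m)) = 1 / (4 * (1 + k))"
    unfolding k_def using m by (simp_all add: complex_eq_iff field_simps)
  have v2: "v\<^sup>2 = 2 - u\<^sup>2" using uv by (simp add: eq_diff_eq add.commute)
  then have v: "v\<^sup>2 - 1 = - (u\<^sup>2 - 1)" by simp
  define P where "P = complex_of_real ((cmod (u + v))\<^sup>2)"
  define Q where "Q = complex_of_real ((cmod (u - v))\<^sup>2)"
  have P: "(u + v) * cnj (u + v) = P" and Q: "(u - v) * cnj (u - v) = Q"
    unfolding P_def Q_def complex_norm_square by simp_all
  have PQ: "(cmod (u + v))\<^sup>2 = 8 * (1 + m) \<longleftrightarrow> P = 8 * (1 + k)" "(cmod (u - v))\<^sup>2 = 8 + 4 * m \<longleftrightarrow> Q = 8 + 4 * k"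
    unfolding P_def Q_def k_def by (auto simp: complex_eq_iff)
  have "(u + v) * (u - v) = u\<^sup>2 - v\<^sup>2" by algebra
  then have pq: "(u + v) * (u - v) = 2 * (u\<^sup>2 - 1)" unfolding v2 by simp
  show ?thesis
  proof (cases "u\<^sup>2 = 1")
    \<comment> \<open>A collision with vortex 1 or 2 would make \<open>u + v\<close> or
      \<open>u - v\<close> vanish, and then both sides of the equivalence fail.\<close>
    case True
    then have "u + v = 0 \<or> u - v = 0" using pq by simp
    then show ?thesis unfolding normalized_equilibrium_iff[OF m z] using True m by auto
  next
    case False
    then have p: "u + v \<noteq> 0" and q: "u - v \<noteq> 0" and U: "u\<^sup>2 - 1 \<noteq> 0" using pq by auto
    have v1: "v\<^sup>2 \<noteq> 1" using U v by auto
    have "(u - v) / (u\<^sup>2 - 1) = 2 / (u + v)" "(u + v) / (u\<^sup>2 - 1) = 2 / (u - v)" using pq p q U by (simp_all add: frac_eq_eq mult_ac)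
    then have e: "u / (u\<^sup>2 - 1) + v / (v\<^sup>2 - 1) = 2 / (u + v)" "u / (u\<^sup>2 - 1) - v / (v\<^sup>2 - 1) = 2 / (u - v)"
      unfolding v divide_minus_right by (simp_all add: diff_divide_distrib add_divide_distrib)
    have inv: "1 / (u\<^sup>2 - 1) + 1 / (v\<^sup>2 - 1) = 0" unfolding v divide_minus_right by simp
    have k4: "4 * (1 + k) \<noteq> 0" using k by (simp only: mult_eq_0_iff) simp
    have aux: "2 / w - 1 / c * x = 0 \<longleftrightarrow> w * x = 2 * c" "2 / w + k / w - 1/4 * x = 0 \<longleftrightarrow> w * x = 8 + 4 * k"
      if "w \<noteq> 0" "c \<noteq> 0" for w x c
      using that by (auto simp: field_simps)
    have "2 / (u + v) - 1 / (4 * (1 + k)) * cnj (u + v) = 0 \<longleftrightarrow> P = 8 * (1 + k)"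
      unfolding aux(1)[OF p k4] P by (simp add: algebra_simps)
    moreover have "2 / (u - v) + k / (u - v) - 1/4 * cnj (u - v) = 0 \<longleftrightarrow> Q = 8 + 4 * k"
      unfolding Q[symmetric] using q by (subst aux(2)[of _ 1]) auto
    ultimately show ?thesis
      unfolding normalized_equilibrium_iff[OF m z] PQ e L L2 k_def[symmetric] using False v1 q inv
      by simp
  qed
qed

section \<open>Asymmetry of the solutions\<close>

lemma dist_reflect_in_line: "dist (reflect_in_line p v x) (reflect_in_line p v y) = dist x y"
proof (cases "v = 0")
  case True
  then show ?thesis by (simp add: reflect_in_line_def)
next
  case False
  define c where "c = 2 * (v \<bullet> (x - y)) / (v \<bullet> v)"
  have "reflect_in_line p v x - reflect_in_line p v y = (x - y) - c *\<^sub>R v"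
    unfolding reflect_in_line_def c_def using False
    by (simp add: algebra_simps inner_diff_right diff_divide_distrib)
  moreover have "(norm ((x - y) - c *\<^sub>R v))\<^sup>2 = (norm (x - y))\<^sup>2"
  proof -
    have "(norm ((x - y) - c *\<^sub>R v))\<^sup>2 = (norm (x - y))\<^sup>2 - c * (2 * (v \<bullet> (x - y)) - c * (v \<bullet> v))"
      unfolding power2_norm_eq_inner inner_diff_left inner_diff_right by (simp add: inner_commute algebra_simps)
    also have "c * (v \<bullet> v) = 2 * (v \<bullet> (x - y))" using False by (simp add: c_def)
    finally show ?thesis by simp
  qed
  ultimately show ?thesis by (simp add: dist_norm)
qed

lemma collinear_if_orthogonal:
  fixes v p :: "real^2"
  assumes v: "v \<noteq> 0" and orth: "\<And>x. x \<in> S \<Longrightarrow> v \<bullet> (x - p) = 0"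
  shows "collinear S"
  unfolding collinear_def
proof (rule exI[of _ "vector [- (v $ 2), v $ 1]"], intro ballI)
  fix x y assume "x \<in> S" "y \<in> S"
  then have "v \<bullet> (x - p) - v \<bullet> (y - p) = 0" using orth by simp
  then have o: "v $ 1 * (x $ 1 - y $ 1) + v $ 2 * (x $ 2 - y $ 2) = 0"
    by (simp add: inner_vec_def sum_2 algebra_simps)
  define n where "n = (v $ 1)\<^sup>2 + (v $ 2)\<^sup>2"
  have n: "n \<noteq> 0" using v by (auto simp: n_def vec_eq_iff forall_2 sum_power2_eq_zero_iff)
  define c where "c = (v $ 1 * (x $ 2 - y $ 2) - v $ 2 * (x $ 1 - y $ 1)) / n"
  have "n * (x $ 1 - y $ 1) = n * (c * - (v $ 2))" "n * (x $ 2 - y $ 2) = n * (c * v $ 1)"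
  proof -
    have "n * c = v $ 1 * (x $ 2 - y $ 2) - v $ 2 * (x $ 1 - y $ 1)" using n by (simp add: c_def)
    then show "n * (x $ 1 - y $ 1) = n * (c * - (v $ 2))" "n * (x $ 2 - y $ 2) = n * (c * v $ 1)"
      using o n_def by algebra+
  qed
  then have "x $ 1 - y $ 1 = c * - (v $ 2)" "x $ 2 - y $ 2 = c * v $ 1"
    using n unfolding mult_cancel_left by simp_all
  then show "\<exists>c. x - y = c *\<^sub>R (vector [- (v $ 2), v $ 1] :: real^2)"
    by (intro exI[of _ c]) (simp add: vec_eq_iff forall_2)
qed

text \<open>A reflection preserving the configuration preserves the sum of squared distances from
  a vortex to all others, so it fixes every vortex when these sums are distinct.\<close>
lemma no_symmetry_axis:
  fixes z :: "real^2^4"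
  assumes inj: "inj (\<lambda>i. \<Sum>k\<in>UNIV. (dist (z $ i) (z $ k))\<^sup>2)" and nc: "\<not> collinear (range (($) z))"
  shows "\<not> has_symmetry_axis z"
proof
  assume "has_symmetry_axis z"
  then obtain p v where v: "v \<noteq> 0" and im: "reflect_in_line p v ` range (($) z) = range (($) z)"
    unfolding has_symmetry_axis_def by auto
  define s where "s = reflect_in_line p v"
  define A where "A = range (($) z)"
  have s: "dist (s x) (s y) = dist x y" for x y by (simp add: s_def dist_reflect_in_line)
  have injs: "inj_on s B" for B by (metis inj_onI dist_eq_0_iff s)
  define \<rho> where "\<rho> x = (\<Sum>y\<in>A. (dist x y)\<^sup>2)" for x
  have "z $ i \<noteq> z $ j" if "i \<noteq> j" for i j
    using inj that by (auto simp: inj_def)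
  then have "inj (($) z)" by (auto simp: inj_def)
  then have r: "\<rho> x = (\<Sum>k\<in>UNIV. (dist x (z $ k))\<^sup>2)" for x
    unfolding \<rho>_def A_def by (subst sum.reindex) auto
  have fx: "s x = x" if x: "x \<in> A" for x
  proof -
    have sx: "s x \<in> A" using im x by (auto simp: s_def A_def)
    have "\<rho> (s x) = (\<Sum>y\<in>s ` A. (dist (s x) y)\<^sup>2)" using im by (simp add: \<rho>_def s_def A_def)
    also have "\<dots> = \<rho> x" by (subst sum.reindex[OF injs]) (simp add: s \<rho>_def)
    finally have e: "\<rho> (s x) = \<rho> x" .
    obtain i j where ij: "x = z $ i" "s x = z $ j" using x sx by (auto simp: A_def)
    have "\<rho> (z $ j) = \<rho> (z $ i)" using e unfolding ij(2) unfolding ij(1) .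
    then have "j = i" using injD[OF inj, of j i] unfolding r by simp
    then show ?thesis using ij by simp
  qed
  have "v \<bullet> (x - p) = 0" if "x \<in> A" for x
    using fx[OF that] v unfolding s_def reflect_in_line_def by simp
  then have "collinear A" using collinear_if_orthogonal[OF v] by blast
  then show False using nc by (simp add: A_def)
qed

text \<open>The moduli and the real part of \<open>pq\<close> express all four squares through
  \<open>a\<close>; the squared imaginary part then determines \<open>a\<close>. The signs stay free
  except for the last equation.\<close>

lemma solution_squares:
  fixes p q :: complex and m :: real
  assumes m: "- 1 < m" "m < 1" and pq: "p\<^sup>2 + q\<^sup>2 = 4"
    and p: "(cmod p)\<^sup>2 = 8 * (1 + m)" and q: "(cmod q)\<^sup>2 = 8 + 4 * m"
  shows "(Re p)\<^sup>2 = (3*m + 5) * (m + 1)" "(Im p)\<^sup>2 = 3 * (1 - m\<^sup>2)"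
    "(Re q)\<^sup>2 = (3*m + 5) * (1 - m)" "(Im q)\<^sup>2 = 3 * (m + 1)\<^sup>2" "Re p * Im p = - (Re q * Im q)"
proof -
  have r: "(Re p)\<^sup>2 - (Im p)\<^sup>2 + (Re q)\<^sup>2 - (Im q)\<^sup>2 = 4"
    using arg_cong[OF pq, of Re] by (simp add: power2_eq_square)
  have "2 * (Re p * Im p + Re q * Im q) = 0"
    using arg_cong[OF pq, of Im] by (simp add: power2_eq_square algebra_simps)
  then have i: "Re p * Im p = - (Re q * Im q)" by simp
  define a where "a = (Re p)\<^sup>2"
  define b where "b = (Re q)\<^sup>2"
  have pi: "(Im p)\<^sup>2 = 8 * (1 + m) - a" and qi: "(Im q)\<^sup>2 = 8 + 4 * m - b"
    using p q unfolding cmod_power2 a_def b_def by simp_all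
  have b: "b = 10 + 6 * m - a" using r unfolding pi qi a_def[symmetric] b_def[symmetric] by simp
  have "a * (Im p)\<^sup>2 = b * (Im q)\<^sup>2" using arg_cong[OF i, of "\<lambda>t. t\<^sup>2"] by (simp add: a_def b_def power_mult_distrib)
  \<comment> \<open>The quadratic terms in \<open>a\<close> cancel, so this equation is linear and
    has a single solution.\<close>
  then have "4 * (a - (3*m + 5) * (m + 1)) = 0" unfolding pi qi b by (simp, algebra)
  then have a: "a = (3*m + 5) * (m + 1)" by simp
  show "(Re p)\<^sup>2 = (3*m + 5) * (m + 1)" using a a_def by simp
  show "(Im p)\<^sup>2 = 3 * (1 - m\<^sup>2)" unfolding pi a by algebra
  show "(Re q)\<^sup>2 = (3*m + 5) * (1 - m)" unfolding b_def[symmetric] b a by algebra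
  show "(Im q)\<^sup>2 = 3 * (m + 1)\<^sup>2" unfolding qi b a by algebra
  show "Re p * Im p = - (Re q * Im q)" by (rule i)
qed

text \<open>The sums of squared distances from each vortex to the others turn out pairwise distinct,
  so \<open>no_symmetry_axis\<close> applies; collinearity would force the imaginary part of
  \<open>u + v\<close> to vanish.\<close>

lemma normalized_asymmetric:
  fixes z :: "real^2^4" and m :: real
  assumes m: "- 1 < m" "m < 1" and z: "cpx (z $ 1) = 1" "cpx (z $ 2) = - 1" "cpx (z $ 3) = u" "cpx (z $ 4) = v"
    and uv: "u\<^sup>2 + v\<^sup>2 = 2" and P: "(cmod (u + v))\<^sup>2 = 8 * (1 + m)" and Q: "(cmod (u - v))\<^sup>2 = 8 + 4 * m"
  shows "asymmetric z"
proof -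
  define p where "p = u + v"
  define q where "q = u - v"
  have u: "u = (p + q) / 2" and v: "v = (p - q) / 2" by (simp_all add: p_def q_def field_simps)
  have "p\<^sup>2 + q\<^sup>2 = 2 * (u\<^sup>2 + v\<^sup>2)" unfolding p_def q_def by algebra
  then have "p\<^sup>2 + q\<^sup>2 = 4" using uv by simp
  note sq = solution_squares[OF m this, OF P[folded p_def] Q[folded q_def]]
  define p1 where "p1 = Re p"
  define p2 where "p2 = Im p"
  define q1 where "q1 = Re q"
  define q2 where "q2 = Im q"
  note sq = sq[folded p1_def p2_def q1_def q2_def]
  have coords: "z $ 1 $ 1 = 1" "z $ 1 $ 2 = 0" "z $ 2 $ 1 = - 1" "z $ 2 $ 2 = 0"
    "z $ 3 $ 1 = (p1 + q1) / 2" "z $ 3 $ 2 = (p2 + q2) / 2" "z $ 4 $ 1 = (p1 - q1) / 2" "z $ 4 $ 2 = (p2 - q2) / 2"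
    using z unfolding u v p1_def p2_def q1_def q2_def by (auto simp: complex_eq_iff)
  define s where "s = p1 * q1 + p2 * q2"
  have m2: "1 - m\<^sup>2 > 0" using m by (simp add: abs_square_less_1)
  have s2: "s\<^sup>2 = 4 * (1 - m\<^sup>2)"
  proof -
    have "s\<^sup>2 = p1\<^sup>2 * q1\<^sup>2 + p2\<^sup>2 * q2\<^sup>2 - 2 * (p1\<^sup>2 * p2\<^sup>2)" unfolding s_def using sq(5) by algebra
    then show ?thesis unfolding sq by algebra
  qed
  have p1: "p1 \<noteq> 0" using sq(1) m by auto
  have s0: "s \<noteq> 0" using s2 m2 by auto
  \<comment> \<open>Squaring twice removes the signs of \<open>x\<close> and \<open>y\<close>, so
    one computation covers all four differences between the two pairs. What is left is a product of
    positive factors.\<close>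
  have key: "4 * (1 + m) + x + y \<noteq> 0" if x: "x\<^sup>2 = 4 * p1\<^sup>2" and y: "y\<^sup>2 = s\<^sup>2" for x y
  proof
    assume "4 * (1 + m) + x + y = 0"
    then have "(x + y)\<^sup>2 = 16 * (1 + m)\<^sup>2" by algebra
    then have "x * y = - 4 * (1 - m\<^sup>2)" using x y unfolding sq s2 by algebra
    then have "x\<^sup>2 * y\<^sup>2 = 16 * (1 - m\<^sup>2)\<^sup>2" by algebra
    then have "(1 - m\<^sup>2) * ((1 + m) * (1 + m)) = 0" unfolding x y sq s2 by algebra
    then show False using m m2 by simp
  qed
  define \<rho> where "\<rho> i = (\<Sum>k\<in>UNIV. (dist (z $ i) (z $ k))\<^sup>2)" for i
  have dist2: "(dist x y)\<^sup>2 = (x $ 1 - y $ 1)\<^sup>2 + (x $ 2 - y $ 2)\<^sup>2" for x y :: "real^2"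
    by (simp add: dist_cpx cmod_power2)
  have q22: "q1\<^sup>2 + q2\<^sup>2 = 8 + 4 * m" unfolding sq by algebra
  have \<rho>12: "\<rho> 1 - \<rho> 2 = - 4 * p1" and \<rho>34: "\<rho> 3 - \<rho> 4 = 2 * s"
    and \<rho>13: "\<rho> 1 - \<rho> 3 = - (4 * (1 + m) + 2 * p1 + s)" and \<rho>14: "\<rho> 1 - \<rho> 4 = - (4 * (1 + m) + 2 * p1 + (- s))"
    and \<rho>23: "\<rho> 2 - \<rho> 3 = - (4 * (1 + m) + (- 2 * p1) + s)" and \<rho>24: "\<rho> 2 - \<rho> 4 = - (4 * (1 + m) + (- 2 * p1) + (- s))"
  proof -
    define a where "a = p1 / 2"
    define b where "b = p2 / 2"
    define c where "c = q1 / 2"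
    define d where "d = q2 / 2"
    have h: "p1 = 2 * a" "p2 = 2 * b" "q1 = 2 * c" "q2 = 2 * d" by (simp_all add: a_def b_def c_def d_def)
    \<comment> \<open>Eliminating \<open>m\<close> through the modulus of \<open>q\<close> turns the
      six differences into polynomial identities in the halved coordinates.\<close>
    have hm: "m = c\<^sup>2 + d\<^sup>2 - 2" using q22 unfolding c_def d_def by (simp add: power_divide)
    have h2: "(p1 + q1) / 2 = a + c" "(p2 + q2) / 2 = b + d" "(p1 - q1) / 2 = a - c" "(p2 - q2) / 2 = b - d"
      unfolding h by simp_all
    show "\<rho> 1 - \<rho> 2 = - 4 * p1" "\<rho> 3 - \<rho> 4 = 2 * s" "\<rho> 1 - \<rho> 3 = - (4 * (1 + m) + 2 * p1 + s)"
      "\<rho> 1 - \<rho> 4 = - (4 * (1 + m) + 2 * p1 + (- s))" "\<rho> 2 - \<rho> 3 = - (4 * (1 + m) + (- 2 * p1) + s)"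
      "\<rho> 2 - \<rho> 4 = - (4 * (1 + m) + (- 2 * p1) + (- s))"
      unfolding \<rho>_def sum_4 dist2 coords h2 s_def unfolding h hm by (simp_all add: power2_eq_square algebra_simps)
  qed
  have "\<rho> 1 \<noteq> \<rho> 2" "\<rho> 3 \<noteq> \<rho> 4" "\<rho> 1 \<noteq> \<rho> 3" "\<rho> 1 \<noteq> \<rho> 4" "\<rho> 2 \<noteq> \<rho> 3" "\<rho> 2 \<noteq> \<rho> 4"
    using \<rho>12 \<rho>34 \<rho>13 \<rho>14 \<rho>23 \<rho>24 p1 s0 key[of "2 * p1" s] key[of "2 * p1" "- s"]
      key[of "- 2 * p1" s] key[of "- 2 * p1" "- s"] by (auto simp: power2_eq_square)
  then have "\<forall>i j. \<rho> i = \<rho> j \<longrightarrow> i = j" unfolding forall_4 by auto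
  then have inj: "inj \<rho>" by (auto simp: inj_def)
  have "\<not> collinear (range (($) z))"
  proof
    assume "collinear (range (($) z))"
    then have "collinear {z $ 2, z $ 1, z $ 3}" "collinear {z $ 2, z $ 1, z $ 4}"
      by (rule collinear_subset, force)+
    have c: "x $ 2 = 0" if "collinear {z $ 2, z $ 1, x}" for x
    proof -
      have "collinear {0, z $ 1 - z $ 2, x - z $ 2}" using that collinear_3[of "z $ 1" "z $ 2" x]
        by (simp add: insert_commute)
      then obtain c where "z $ 1 - z $ 2 = 0 \<or> x - z $ 2 = 0 \<or> x - z $ 2 = c *\<^sub>R (z $ 1 - z $ 2)"
        unfolding collinear_lemma by auto
      then show ?thesis by (auto simp: vec_eq_iff forall_2 coords)
    qed
    have "p2 = 0" using c[OF \<open>collinear {z $ 2, z $ 1, z $ 3}\<close>] c[OF \<open>collinear {z $ 2, z $ 1, z $ 4}\<close>]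
      by (simp add: coords)
    then show False using sq(2) m2 by simp
  qed
  then show ?thesis
    unfolding asymmetric_def using no_symmetry_axis inj unfolding \<rho>_def by blast
qed

section \<open>Similarity\<close>

definition vec_of :: "complex \<Rightarrow> real^2" where
  "vec_of c = vector [Re c, Im c]"

lemma cpx_vec_of [simp]: "cpx (vec_of c) = c"
  by (simp add: cpx_def vec_of_def)

lemma vec_of_cpx [simp]: "vec_of (cpx v) = v"
  by (simp add: vec_of_def vec_eq_iff forall_2)

text \<open>Rotation and positive scaling together are multiplication by a nonzero complex number,
  with \<open>s\<close> as its modulus and the first column of \<open>R\<close> as its
  direction.\<close>

lemma similar_configurations_iff:
  "similar_configurations z w \<longleftrightarrow> (\<exists>a b. a \<noteq> 0 \<and> (\<forall>i. cpx (w $ i) = a * cpx (z $ i) + b))"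
proof
  assume "similar_configurations z w"
  then obtain s R t where s: "s > 0" and R: "rotation_matrix R" and w: "\<And>i. w $ i = s *\<^sub>R (R *v z $ i) + t"
    unfolding similar_configurations_def by auto
  define c where "c = R $ 1 $ 1"
  define d where "d = R $ 2 $ 1"
  have "transpose R ** R = mat 1" and det: "R $ 1 $ 1 * R $ 2 $ 2 - R $ 1 $ 2 * R $ 2 $ 1 = 1"
    using R by (simp_all add: rotation_matrix_def orthogonal_matrix det_2)
  then have "(transpose R ** R) $ 1 $ 1 = 1" "(transpose R ** R) $ 1 $ 2 = 0" "(transpose R ** R) $ 2 $ 2 = 1"
    by (simp_all add: mat_def)
  then have 1: "c\<^sup>2 + d\<^sup>2 = 1" "c * R $ 1 $ 2 + d * R $ 2 $ 2 = 0"
    unfolding c_def d_def by (simp_all add: matrix_matrix_mult_def transpose_def sum_2 power2_eq_square)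
  \<comment> \<open>Orthogonality of the columns together with determinant 1 makes the second column
    the first one turned by a right angle.\<close>
  have R2: "R $ 1 $ 2 = - d" "R $ 2 $ 2 = c"
    using 1 det unfolding c_def[symmetric] d_def[symmetric] by algebra+
  have "cpx (R *v x) = Complex c d * cpx x" for x
    by (simp add: complex_eq_iff matrix_vector_mult_def sum_2 R2 c_def[symmetric] d_def[symmetric])
  then have "cpx (w $ i) = (of_real s * Complex c d) * cpx (z $ i) + cpx t" for i
    by (simp add: w scaleR_conv_of_real[where 'a=complex] mult.assoc)
  moreover have "of_real s * Complex c d \<noteq> 0" using s 1(1) by (auto simp: complex_eq_iff)
  ultimately show "\<exists>a b. a \<noteq> 0 \<and> (\<forall>i. cpx (w $ i) = a * cpx (z $ i) + b)" by blast
next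
  assume "\<exists>a b. a \<noteq> 0 \<and> (\<forall>i. cpx (w $ i) = a * cpx (z $ i) + b)"
  then obtain a b where a: "a \<noteq> 0" and w: "\<And>i. cpx (w $ i) = a * cpx (z $ i) + b" by auto
  define s where "s = cmod a"
  define c where "c = Re a / s"
  define d where "d = Im a / s"
  have s: "s > 0" using a by (simp add: s_def)
  have cd: "c * c + d * d = 1"
  proof -
    have "s * s = Re a * Re a + Im a * Im a" using cmod_power2[of a] by (simp add: s_def power2_eq_square)
    moreover have "c * c + d * d = (Re a * Re a + Im a * Im a) / (s * s)"
      by (simp add: c_def d_def add_divide_distrib)
    ultimately show ?thesis using s a by (auto simp: complex_eq_iff)
  qed
  define R :: "real^2^2" where "R = vector [vector [c, - d], vector [d, c]]"
  have R: "rotation_matrix R"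
    unfolding rotation_matrix_def orthogonal_matrix using cd
    by (simp add: det_2 R_def vec_eq_iff forall_2 matrix_matrix_mult_def transpose_def sum_2 mat_def)
  have "cpx (R *v x) = Complex c d * cpx x" for x
    by (simp add: complex_eq_iff matrix_vector_mult_def sum_2 R_def)
  moreover have "a = of_real s * Complex c d"
    using s by (simp add: complex_eq_iff c_def d_def)
  ultimately have "w $ i = s *\<^sub>R (R *v z $ i) + vec_of b" for i
    unfolding cpx_eq_iff[symmetric] w by (simp add: scaleR_conv_of_real[where 'a=complex] mult.assoc)
  then show "similar_configurations z w"
    unfolding similar_configurations_def using s R by blast
qed

lemma equiv_similarity_relation: "equiv UNIV similarity_relation"
proof (rule equivI)
  show "refl similarity_relation"
  proof (rule refl_onI)
    fix z :: "real^2^4"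
    have "\<forall>i. cpx (z $ i) = 1 * cpx (z $ i) + 0" by simp
    then show "(z, z) \<in> similarity_relation"
      unfolding similarity_relation_def similar_configurations_iff using one_neq_zero by blast
  qed
  show "sym similarity_relation"
  proof (rule symI)
    fix z w assume "(z, w) \<in> similarity_relation"
    then obtain a b where ab: "a \<noteq> 0" "\<And>i. cpx (w $ i) = a * cpx (z $ i) + b"
      by (auto simp: similarity_relation_def similar_configurations_iff)
    then have "cpx (z $ i) = (1 / a) * cpx (w $ i) + (- b / a)" for i
      by (simp add: field_simps)
    moreover have "1 / a \<noteq> 0" using ab by simp
    ultimately show "(w, z) \<in> similarity_relation"
      unfolding similarity_relation_def similar_configurations_iff by blast
  qed
  show "trans similarity_relation"
  proof (rule transI)
    fix x y z assume "(x, y) \<in> similarity_relation" "(y, z) \<in> similarity_relation"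
    then obtain a b c d where *: "a \<noteq> 0" "\<And>i. cpx (y $ i) = a * cpx (x $ i) + b" "c \<noteq> 0" "\<And>i. cpx (z $ i) = c * cpx (y $ i) + d"
      by (auto simp: similarity_relation_def similar_configurations_iff)
    then have "cpx (z $ i) = (c * a) * cpx (x $ i) + (c * b + d)" for i by (simp add: algebra_simps)
    moreover have "c * a \<noteq> 0" using * by simp
    ultimately show "(x, z) \<in> similarity_relation"
      unfolding similarity_relation_def similar_configurations_iff by blast
  qed
qed simp

lemma similar_configurations_sym: "similar_configurations z w \<Longrightarrow> similar_configurations w z"
  using equiv_similarity_relation by (auto simp: equiv_def sym_def similarity_relation_def)

lemma similar_configurations_trans:
  "similar_configurations x y \<Longrightarrow> similar_configurations y z \<Longrightarrow> similar_configurations x z"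
  using equiv_similarity_relation by (auto simp: equiv_def trans_def similarity_relation_def)

text \<open>Multiplication by \<open>a\<close> scales all inner products by its squared modulus,
  which cancels in the reflection formula; the similarity therefore carries one reflection into
  another.\<close>

lemma similar_has_symmetry_axis:
  assumes "similar_configurations z w" "has_symmetry_axis z"
  shows "has_symmetry_axis w"
proof -
  obtain a b where a: "a \<noteq> 0" and w: "\<And>i. cpx (w $ i) = a * cpx (z $ i) + b"
    using assms(1) by (auto simp: similar_configurations_iff)
  obtain p v where v: "v \<noteq> 0" and im: "reflect_in_line p v ` range (($) z) = range (($) z)"
    using assms(2) unfolding has_symmetry_axis_def by auto
  define T where "T x = vec_of (a * cpx x + b)" for x
  define v' where "v' = vec_of (a * cpx v)"
  have wT: "($) w = T \<circ> ($) z" by (auto simp: T_def w[symmetric])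
  have inner: "x \<bullet> y = Re (cnj (cpx x) * cpx y)" for x y :: "real^2"
    by (simp add: inner_vec_def sum_2)
  have refl: "reflect_in_line (T p) v' (T x) = T (reflect_in_line p v x)" for x
  proof -
    have sc: "Re (cnj (a * c) * (a * d)) = (cmod a)\<^sup>2 * Re (cnj c * d)" for c d
      unfolding cmod_power2 by (simp add: power2_eq_square algebra_simps)
    have d: "cpx (T x - T p) = a * (cpx x - cpx p)" by (simp add: T_def algebra_simps)
    have v'c: "cpx v' = a * cpx v" by (simp add: v'_def)
    have "v' \<bullet> (T x - T p) = (cmod a)\<^sup>2 * (v \<bullet> (x - p))" "v' \<bullet> v' = (cmod a)\<^sup>2 * (v \<bullet> v)"
      unfolding inner d v'c sc by simp_all
    then have "(2 * (v' \<bullet> (T x - T p)) / (v' \<bullet> v')) = (2 * (v \<bullet> (x - p)) / (v \<bullet> v))"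
      using a by simp
    then show ?thesis
      unfolding reflect_in_line_def cpx_eq_iff[symmetric]
      by (simp add: T_def v'_def scaleR_conv_of_real[where 'a=complex] algebra_simps)
  qed
  have "reflect_in_line (T p) v' ` range (($) w) = T ` (reflect_in_line p v ` range (($) z))"
    unfolding wT by (auto simp: refl image_iff)
  also have "\<dots> = range (($) w)" unfolding im wT by (auto simp: image_iff)
  finally have "reflect_in_line (T p) v' ` range (($) w) = range (($) w)" .
  moreover have "v' \<noteq> 0" using a v by (simp add: v'_def cpx_eq_0_iff[symmetric])
  ultimately show ?thesis unfolding has_symmetry_axis_def by blast
qed

lemma similar_collinear:
  assumes "similar_configurations z w" "collinear (range (($) z))"
  shows "collinear (range (($) w))"
proof -
  obtain a b where w: "\<And>i. cpx (w $ i) = a * cpx (z $ i) + b"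
    using assms(1) by (auto simp: similar_configurations_iff)
  obtain u where u: "\<And>i j. \<exists>c. z $ i - z $ j = c *\<^sub>R u"
    using assms(2) unfolding collinear_def by blast
  have "\<exists>c. w $ i - w $ j = c *\<^sub>R vec_of (a * cpx u)" for i j
  proof -
    obtain c where c: "z $ i - z $ j = c *\<^sub>R u" using u by blast
    have "cpx (w $ i - w $ j) = a * cpx (z $ i - z $ j)" by (simp add: w algebra_simps)
    then have "w $ i - w $ j = c *\<^sub>R vec_of (a * cpx u)"
      unfolding c cpx_eq_iff[symmetric] by (simp add: scaleR_conv_of_real[where 'a=complex])
    then show ?thesis by blast
  qed
  then show ?thesis unfolding collinear_def by blast
qed

lemma similar_asymmetric:
  "similar_configurations z w \<Longrightarrow> asymmetric z \<Longrightarrow> asymmetric w"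
  unfolding asymmetric_def
  by (meson similar_has_symmetry_axis similar_collinear similar_configurations_sym)

text \<open>Scaling multiplies squared distances by \<open>n\<close>. Dividing the angular velocity
  by \<open>n\<close> as well makes each equation the old one times the nonzero number
  \<open>a / of_real n\<close>.\<close>

lemma similar_relative_equilibrium:
  fixes z w :: "real^2^4"
  assumes m: "- 1 < m" and "similar_configurations z w" "relative_equilibrium (circulations m) z"
  shows "relative_equilibrium (circulations m) w"
proof -
  obtain a b where a: "a \<noteq> 0" and w: "\<And>i. cpx (w $ i) = a * cpx (z $ i) + b"
    using assms(2) by (auto simp: similar_configurations_iff)
  obtain \<omega> where \<omega>: "relative_equilibrium_with (circulations m) \<omega> z"
    using assms(3) by (auto simp: relative_equilibrium_def)
  define n where "n = (cmod a)\<^sup>2"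
  have n: "n > 0" using a by (simp add: n_def)
  define \<omega>' where "\<omega>' = \<omega> / n"
  have d: "cpx (w $ i) - cpx (w $ j) = a * (cpx (z $ i) - cpx (z $ j))" for i j
    by (simp add: w algebra_simps)
  have D: "(cmod (cpx (w $ i) - cpx (w $ j)))\<^sup>2 = n * (cmod (cpx (z $ i) - cpx (z $ j)))\<^sup>2" for i j
    unfolding d by (simp add: norm_mult power_mult_distrib n_def)
  have ne: "cpx (w $ i) = cpx (w $ j) \<longleftrightarrow> cpx (z $ i) = cpx (z $ j)" for i j
    using a by (simp add: w)
  have f: "(1 / (n * R) - \<omega>' / (2 + 2*m)) *\<^sub>R (a * x) = (a / of_real n) * ((1 / R - \<omega> / (2 + 2*m)) *\<^sub>R x)"
    "(m * (1 / (n * R) - \<omega>' / (2 + 2*m))) *\<^sub>R (a * x) = (a / of_real n) * ((m * (1 / R - \<omega> / (2 + 2*m))) *\<^sub>R x)" for R x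
  proof -
    have *: "1 / (n * R) - \<omega>' / (2 + 2*m) = (1 / R - \<omega> / (2 + 2*m)) / n"
      by (simp add: \<omega>'_def diff_divide_distrib mult.commute)
    show "(1 / (n * R) - \<omega>' / (2 + 2*m)) *\<^sub>R (a * x) = (a / of_real n) * ((1 / R - \<omega> / (2 + 2*m)) *\<^sub>R x)"
      "(m * (1 / (n * R) - \<omega>' / (2 + 2*m))) *\<^sub>R (a * x) = (a / of_real n) * ((m * (1 / R - \<omega> / (2 + 2*m))) *\<^sub>R x)"
      unfolding * by (simp_all add: scaleR_conv_of_real[where 'a=complex])
  qed
  have "\<omega> \<noteq> 0" using \<omega> by (simp add: relative_equilibrium_with_def)
  then have \<omega>0: "(\<omega>' \<noteq> 0) = (\<omega> \<noteq> 0)" using n by (simp add: \<omega>'_def)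
  have zero: "(a / of_real n) * x = 0 \<longleftrightarrow> x = 0" for x using a n by simp
  have "relative_equilibrium_with (circulations m) \<omega>' w"
    unfolding relative_equilibrium_with_iff[OF m] D
    unfolding ne d f distrib_left[symmetric] zero \<omega>0
    using \<omega>[unfolded relative_equilibrium_with_iff[OF m]] .
  then show ?thesis by (auto simp: relative_equilibrium_def)
qed

lemma normalize_configuration:
  fixes z :: "real^2^4"
  assumes "z $ 1 \<noteq> z $ 2"
  shows "\<exists>w. similar_configurations z w \<and> cpx (w $ 1) = 1 \<and> cpx (w $ 2) = - 1"
proof -
  define \<delta> where "\<delta> = cpx (z $ 1) - cpx (z $ 2)"
  have \<delta>: "\<delta> \<noteq> 0" using assms by (simp add: \<delta>_def cpx_eq_iff)
  \<comment> \<open>The affine map that sends vortex 1 to 1 and vortex 2 to -1.\<close>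
  define w :: "real^2^4" where "w = (\<chi> i. vec_of ((2 / \<delta>) * cpx (z $ i) + (- (cpx (z $ 1) + cpx (z $ 2)) / \<delta>)))"
  have w: "cpx (w $ i) = (2 / \<delta>) * cpx (z $ i) + (- (cpx (z $ 1) + cpx (z $ 2)) / \<delta>)" for i by (simp add: w_def)
  have "2 / \<delta> \<noteq> 0" using \<delta> by simp
  then have "similar_configurations z w" unfolding similar_configurations_iff using w by blast
  moreover have "cpx (w $ 1) = 1" "cpx (w $ 2) = - 1"
    unfolding w using \<delta> by (simp_all add: field_simps) (simp_all add: \<delta>_def)
  ultimately show ?thesis by blast
qed

text \<open>A complex affine map that fixes 1 and -1 is the identity, so normalized configurations
  are unique in their similarity classes.\<close>

lemma similar_normalized_eq:
  assumes "similar_configurations z w" "cpx (z $ 1) = 1" "cpx (z $ 2) = - 1" "cpx (w $ 1) = 1" "cpx (w $ 2) = - 1"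
  shows "z = w"
proof -
  obtain a b where w: "\<And>i. cpx (w $ i) = a * cpx (z $ i) + b"
    using assms(1) by (auto simp: similar_configurations_iff)
  have "1 = a + b" "- 1 = - a + b" using w[of 1] w[of 2] assms by simp_all
  then have b: "b = 0" by algebra
  then have "a = 1" using \<open>1 = a + b\<close> by simp
  then have "cpx (w $ i) = cpx (z $ i)" for i using w b by simp
  then show ?thesis by (simp add: cpx_eq_iff vec_eq_iff)
qed

section \<open>The eight solutions\<close>

text \<open>The sign \<open>h\<close> selects one of two conjugate values of the squares of
  \<open>z\<^sub>3 + z\<^sub>4\<close> and \<open>z\<^sub>3 - z\<^sub>4\<close>, while
  \<open>e\<close> and \<open>d\<close> select their square roots.\<close>

definition signed_solution :: "real \<Rightarrow> real \<times> real \<times> real \<Rightarrow> real^2^4" where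
  "signed_solution m = (\<lambda>(e, d, h). vector
    [vector [1, 0],
     vector [- 1, 0],
     vector [(e * (sqrt (3*m + 5) * sqrt (m + 1)) - d * (sqrt (3*m + 5) * sqrt (1 - m))) / 2,
             h * (e * (sqrt 3 * sqrt (1 - m\<^sup>2)) + d * (sqrt 3 * (m + 1))) / 2],
     vector [(e * (sqrt (3*m + 5) * sqrt (m + 1)) + d * (sqrt (3*m + 5) * sqrt (1 - m))) / 2,
             h * (e * (sqrt 3 * sqrt (1 - m\<^sup>2)) - d * (sqrt 3 * (m + 1))) / 2]])"

definition signs :: "(real \<times> real \<times> real) set" where
  "signs = {1, - 1} \<times> {1, - 1} \<times> {1, - 1}"

text \<open>\<open>z\<^sub>3 + z\<^sub>4\<close> and \<open>z\<^sub>3 - z\<^sub>4\<close> for the configuration with the given signs\<close>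
definition sum_point :: "real \<Rightarrow> real \<times> real \<times> real \<Rightarrow> complex" where
  "sum_point m = (\<lambda>(e, d, h). Complex (e * (sqrt (3*m + 5) * sqrt (m + 1))) (h * e * (sqrt 3 * sqrt (1 - m\<^sup>2))))"

definition diff_point :: "real \<Rightarrow> real \<times> real \<times> real \<Rightarrow> complex" where
  "diff_point m = (\<lambda>(e, d, h). Complex (- d * (sqrt (3*m + 5) * sqrt (1 - m))) (h * d * (sqrt 3 * (m + 1))))"

lemma signed_solution_nth:
  "signed_solution m (e, d, h) $ 1 $ 1 = 1" "signed_solution m (e, d, h) $ 1 $ 2 = 0"
  "signed_solution m (e, d, h) $ 2 $ 1 = - 1" "signed_solution m (e, d, h) $ 2 $ 2 = 0"
  "signed_solution m (e, d, h) $ 3 $ 1 = (e * (sqrt (3*m + 5) * sqrt (m + 1)) - d * (sqrt (3*m + 5) * sqrt (1 - m))) / 2"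
  "signed_solution m (e, d, h) $ 3 $ 2 = h * (e * (sqrt 3 * sqrt (1 - m\<^sup>2)) + d * (sqrt 3 * (m + 1))) / 2"
  "signed_solution m (e, d, h) $ 4 $ 1 = (e * (sqrt (3*m + 5) * sqrt (m + 1)) + d * (sqrt (3*m + 5) * sqrt (1 - m))) / 2"
  "signed_solution m (e, d, h) $ 4 $ 2 = h * (e * (sqrt 3 * sqrt (1 - m\<^sup>2)) - d * (sqrt 3 * (m + 1))) / 2"
  by (simp_all add: signed_solution_def vector_4)

lemma solution_eq_signed: "solution m = signed_solution m (1, 1, 1)"
  unfolding solution_def signed_solution_def
  by (simp add: vec_eq_iff forall_4 forall_2 vector_4 algebra_simps)

lemma cpx_signed_solution:
  "cpx (signed_solution m s $ 1) = 1" "cpx (signed_solution m s $ 2) = - 1"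
  "cpx (signed_solution m s $ 3) = (sum_point m s + diff_point m s) / 2"
  "cpx (signed_solution m s $ 4) = (sum_point m s - diff_point m s) / 2"
  by (cases s; simp add: signed_solution_nth sum_point_def diff_point_def complex_eq_iff ring_distribs mult_ac)+

lemma signed_points_norm:
  assumes m: "- 1 < m" "m < 1" and s: "s \<in> signs"
  shows "(sum_point m s)\<^sup>2 + (diff_point m s)\<^sup>2 = 4" "(cmod (sum_point m s))\<^sup>2 = 8 * (1 + m)"
    "(cmod (diff_point m s))\<^sup>2 = 8 + 4 * m"
proof -
  obtain e d h where edh: "s = (e, d, h)" by (cases s)
  have sg: "e * e = 1" "d * d = 1" "h * h = 1" using s by (auto simp: edh signs_def)
  define A where "A = sqrt (3*m + 5)"
  define B where "B = sqrt (m + 1)"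
  define C where "C = sqrt (1 - m)"
  define D where "D = sqrt 3"
  have sq: "A * A = 3*m + 5" "B * B = m + 1" "C * C = 1 - m" "D * D = 3"
    using m by (simp_all add: A_def B_def C_def D_def)
  have "1 - m\<^sup>2 = (m + 1) * (1 - m)" by algebra
  then have BC: "sqrt (1 - m\<^sup>2) = B * C" by (simp add: B_def C_def real_sqrt_mult)
  have P: "sum_point m s = Complex (e * (A * B)) (h * e * (D * (B * C)))"
    and Q: "diff_point m s = Complex (- d * (A * C)) (h * d * (D * (m + 1)))"
    unfolding edh sum_point_def diff_point_def BC by (simp_all add: A_def B_def C_def D_def)
  show "(sum_point m s)\<^sup>2 + (diff_point m s)\<^sup>2 = 4"
  proof (rule complex_eqI)
    have *: "Re ((Complex x y)\<^sup>2 + (Complex x' y')\<^sup>2) = x\<^sup>2 - y\<^sup>2 + (x'\<^sup>2 - y'\<^sup>2)"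
      "Im ((Complex x y)\<^sup>2 + (Complex x' y')\<^sup>2) = 2 * (x * y + x' * y')" for x y x' y'
      by (simp_all add: power2_eq_square)
    have "(e * (A * B))\<^sup>2 - (h * e * (D * (B * C)))\<^sup>2 + ((- d * (A * C))\<^sup>2 - (h * d * (D * (m + 1)))\<^sup>2) = 4"
      using sg sq by algebra
    then show "Re ((sum_point m s)\<^sup>2 + (diff_point m s)\<^sup>2) = Re 4" unfolding P Q * by simp
    have "(e * (A * B)) * (h * e * (D * (B * C))) + (- d * (A * C)) * (h * d * (D * (m + 1))) = 0"
      using sg sq by algebra
    then show "Im ((sum_point m s)\<^sup>2 + (diff_point m s)\<^sup>2) = Im 4" unfolding P Q * by (simp only:) simp
  qed
  have "(e * (A * B))\<^sup>2 + (h * e * (D * (B * C)))\<^sup>2 = 8 * (1 + m)" using sg sq by algebra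
  then show "(cmod (sum_point m s))\<^sup>2 = 8 * (1 + m)" unfolding P cmod_power2 by simp
  have "(d * (A * C))\<^sup>2 + (h * d * (D * (m + 1)))\<^sup>2 = 8 + 4 * m" using sg sq by algebra
  then show "(cmod (diff_point m s))\<^sup>2 = 8 + 4 * m" unfolding Q cmod_power2 by simp
qed

lemma signed_solution_equilibrium:
  assumes m: "- 1 < m" "m < 1" and s: "s \<in> signs"
  shows "relative_equilibrium_with (circulations m) (1/2) (signed_solution m s)" "asymmetric (signed_solution m s)"
proof -
  define p where "p = sum_point m s"
  define q where "q = diff_point m s"
  note pq = signed_points_norm[OF m s, folded p_def q_def]
  note z = cpx_signed_solution[of m s, folded p_def q_def]
  have "((p + q) / 2)\<^sup>2 + ((p - q) / 2)\<^sup>2 = (p\<^sup>2 + q\<^sup>2) / 2"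
    by (simp add: power2_eq_square field_simps)
  then have 1: "((p + q) / 2)\<^sup>2 + ((p - q) / 2)\<^sup>2 = 2" using pq(1) by simp
  have "(p + q) / 2 + (p - q) / 2 = p" "(p + q) / 2 - (p - q) / 2 = q" by (simp_all add: field_simps)
  then have 2: "(cmod ((p + q) / 2 + (p - q) / 2))\<^sup>2 = 8 * (1 + m)" "(cmod ((p + q) / 2 - (p - q) / 2))\<^sup>2 = 8 + 4 * m"
    using pq(2,3) by simp_all
  show "asymmetric (signed_solution m s)" using normalized_asymmetric[OF m z 1 2] .
  show "relative_equilibrium_with (circulations m) (1/2) (signed_solution m s)"
    using normalized_equilibrium_half_iff[OF m(1) z 1] 2 by blast
qed

text \<open>The absolute values of the four coordinates of \<open>p\<close> and \<open>q\<close> are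
  known. Of the sixteen sign patterns, the relation between the two products of coordinates admits
  eight.\<close>

lemma normalized_equilibrium_signed:
  fixes z :: "real^2^4"
  assumes m: "- 1 < m" "m < 1" and z12: "cpx (z $ 1) = 1" "cpx (z $ 2) = - 1"
    and re: "relative_equilibrium_with (circulations m) \<omega> z" and asym: "asymmetric z"
  shows "z \<in> signed_solution m ` signs"
proof -
  define u where "u = cpx (z $ 3)"
  define v where "v = cpx (z $ 4)"
  note z = z12 u_def[symmetric] v_def[symmetric]
  note w = asymmetric_equilibrium[OF m z re asym]
  have 2: "(cmod (u + v))\<^sup>2 = 8 * (1 + m)" "(cmod (u - v))\<^sup>2 = 8 + 4 * m"
    using normalized_equilibrium_half_iff[OF m(1) z w(2)] re[unfolded w(1)] by blast+
  define p where "p = u + v"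
  define q where "q = u - v"
  have u: "u = (p + q) / 2" and v: "v = (p - q) / 2" by (simp_all add: p_def q_def)
  have "p\<^sup>2 + q\<^sup>2 = 2 * (u\<^sup>2 + v\<^sup>2)" unfolding p_def q_def by algebra
  then have "p\<^sup>2 + q\<^sup>2 = 4" using w(2) by simp
  note sq = solution_squares[OF m this, OF 2[folded p_def q_def]]
  have m2: "1 - m\<^sup>2 > 0" using m by (simp add: abs_square_less_1)
  define A where "A = sqrt (3*m + 5) * sqrt (m + 1)"
  define C where "C = sqrt 3 * sqrt (1 - m\<^sup>2)"
  define B where "B = sqrt (3*m + 5) * sqrt (1 - m)"
  define D where "D = sqrt 3 * (m + 1)"
  have pos: "A > 0" "B > 0" "C > 0" "D > 0" using m m2 by (simp_all add: A_def B_def C_def D_def)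
  have "A\<^sup>2 = (3*m + 5) * (m + 1)" "C\<^sup>2 = 3 * (1 - m\<^sup>2)" "B\<^sup>2 = (3*m + 5) * (1 - m)" "D\<^sup>2 = 3 * (m + 1)\<^sup>2"
    unfolding A_def B_def C_def D_def using m m2 by (simp_all add: power_mult_distrib)
  then have "(Re p)\<^sup>2 = A\<^sup>2" "(Im p)\<^sup>2 = C\<^sup>2" "(Re q)\<^sup>2 = B\<^sup>2" "(Im q)\<^sup>2 = D\<^sup>2" using sq by simp_all
  then have "Re p = A \<or> Re p = - A" "Im p = C \<or> Im p = - C" "Re q = B \<or> Re q = - B" "Im q = D \<or> Im q = - D"
    by (simp_all add: power2_eq_iff)
  note abcd = this
  obtain e where e: "e \<in> {1, - 1}" "Re p = e * A" using abcd(1) by force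
  obtain f where f: "f \<in> {1, - 1}" "Im p = f * C" using abcd(2) by force
  obtain g where g: "g \<in> {1, - 1}" "Re q = g * B" using abcd(3) by force
  obtain k where k: "k \<in> {1, - 1}" "Im q = k * D" using abcd(4) by force
  have "A * C > 0" "B * D > 0" using pos by simp_all
  moreover have "e * f * (A * C) = - (g * k * (B * D))" using sq(5) unfolding e f g k by (simp add: mult_ac)
  \<comment> \<open>The magnitudes \<open>A * C\<close> and \<open>B * D\<close> are positive, so
    the equation between the two products determines their relative sign.\<close>
  ultimately have ef: "e * f = - (g * k)" using e(1) f(1) g(1) k(1) by (elim insertE emptyE) simp_all
  \<comment> \<open>The first entry is the sign of \<open>Re p\<close>, the second is opposite to
    the sign of \<open>Re q\<close> by the convention in \<open>diff_point\<close>, and the third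
    records whether the coordinates of \<open>p\<close> have equal signs.\<close>
  define s where "s = (e, - g, e * f)"
  have s: "s \<in> signs" using e(1) f(1) g(1) unfolding s_def signs_def by (elim insertE emptyE) simp_all
  have ee: "e * e = 1" "g * g = 1" using e(1) g(1) by auto
  have "e * f * e * C = f * C" using ee(1) by algebra
  then have "sum_point m s = p"
    by (simp add: s_def sum_point_def complex_eq_iff e(2) f(2) A_def C_def)
  moreover have "e * f * (- g) * D = k * D" using ee(2) ef by algebra
  then have "diff_point m s = q"
    by (simp add: s_def diff_point_def complex_eq_iff g(2) k(2) B_def D_def)
  ultimately have "\<forall>i. cpx (signed_solution m s $ i) = cpx (z $ i)"
    unfolding forall_4 cpx_signed_solution z u[symmetric] v[symmetric] by (simp add: u v)
  then have "z = signed_solution m s" by (simp add: vec_eq_iff[of z] cpx_eq_iff)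
  then show ?thesis using s by blast
qed

lemma card_signed_solutions:
  assumes m: "- 1 < m" "m < 1"
  shows "card (signed_solution m ` signs) = 8"
proof -
  have "inj_on (signed_solution m) signs"
  proof (rule inj_onI)
    fix s s' assume s: "s \<in> signs" "s' \<in> signs" and eq: "signed_solution m s = signed_solution m s'"
    have 1: "(sum_point m s + diff_point m s) / 2 = (sum_point m s' + diff_point m s') / 2"
      using cpx_signed_solution(3) eq by metis
    have 2: "(sum_point m s - diff_point m s) / 2 = (sum_point m s' - diff_point m s') / 2"
      using cpx_signed_solution(4) eq by metis
    have p: "sum_point m s = sum_point m s'" and q: "diff_point m s = diff_point m s'" using 1 2
      by (auto simp: complex_eq_iff)
    obtain e d h e' d' h' where ss: "s = (e, d, h)" "s' = (e', d', h')" by (cases s; cases s')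
    have m2: "1 - m\<^sup>2 > 0" using m by (simp add: abs_square_less_1)
    have nz: "sqrt (3*m + 5) * sqrt (m + 1) \<noteq> 0" "sqrt 3 * sqrt (1 - m\<^sup>2) \<noteq> 0" "sqrt (3*m + 5) * sqrt (1 - m) \<noteq> 0"
      using m m2 by simp_all
    have "e = e'" "h * e = h' * e'" "d = d'"
      using p q unfolding ss sum_point_def diff_point_def complex.inject prod.case mult_minus_left neg_equal_iff_equal mult_cancel_right
      using nz by blast+
    then show "s = s'" using s unfolding ss by (auto simp: signs_def)
  qed
  then have "card (signed_solution m ` signs) = card signs" by (rule card_image)
  also have "\<dots> = 8" by (simp add: signs_def card_cartesian_product)
  finally show ?thesis .
qed

section \<open>Counting and comparing similarity classes\<close>

lemma equilibrium_similar_signed: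
  assumes m: "- 1 < m" "m < 1" and z: "z \<in> asymmetric_relative_equilibria m"
  shows "\<exists>s\<in>signs. similar_configurations z (signed_solution m s)"
proof -
  have "z $ 1 \<noteq> z $ 2"
    using z by (auto simp: asymmetric_relative_equilibria_def relative_equilibrium_def
      relative_equilibrium_with_def collision_free_def)
  then obtain w where w: "similar_configurations z w" "cpx (w $ 1) = 1" "cpx (w $ 2) = - 1"
    using normalize_configuration by blast
  have "asymmetric w" using similar_asymmetric[OF w(1)] z by (simp add: asymmetric_relative_equilibria_def)
  moreover obtain \<omega> where "relative_equilibrium_with (circulations m) \<omega> w"
    using similar_relative_equilibrium[OF m(1) w(1)] z
    by (auto simp: asymmetric_relative_equilibria_def relative_equilibrium_def)
  ultimately have "w \<in> signed_solution m ` signs"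
    using normalized_equilibrium_signed[OF m w(2,3)] by blast
  then show ?thesis using w(1) by auto
qed

text \<open>The eight normalized configurations represent every class, and distinct ones are not
  similar because normalization leaves no freedom.\<close>

lemma card_asymmetric_classes:
  assumes m: "- 1 < m" "m < 1"
  shows "card (asymmetric_relative_equilibria m // similarity_relation) = 8"
proof -
  let ?N = "signed_solution m ` signs"
  have N: "?N \<subseteq> asymmetric_relative_equilibria m"
    using signed_solution_equilibrium[OF m] by (auto simp: asymmetric_relative_equilibria_def relative_equilibrium_def)
  have "asymmetric_relative_equilibria m // similarity_relation = (\<lambda>n. similarity_relation `` {n}) ` ?N"
  proof (intro equalityI subsetI)
    fix c assume "c \<in> asymmetric_relative_equilibria m // similarity_relation"
    then obtain z where z: "z \<in> asymmetric_relative_equilibria m" "c = similarity_relation `` {z}"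
      by (auto elim: quotientE)
    obtain s where s: "s \<in> signs" "similar_configurations z (signed_solution m s)"
      using equilibrium_similar_signed[OF m z(1)] by blast
    then have "c = similarity_relation `` {signed_solution m s}"
      unfolding z(2) using equiv_class_eq[OF equiv_similarity_relation] by (simp add: similarity_relation_def)
    then show "c \<in> (\<lambda>n. similarity_relation `` {n}) ` ?N" using s(1) by blast
  next
    fix c assume "c \<in> (\<lambda>n. similarity_relation `` {n}) ` ?N"
    then show "c \<in> asymmetric_relative_equilibria m // similarity_relation"
      using N by (auto intro: quotientI)
  qed
  moreover have "inj_on (\<lambda>n. similarity_relation `` {n}) ?N"
  proof (rule inj_onI)
    fix n n' assume n: "n \<in> ?N" "n' \<in> ?N" "similarity_relation `` {n} = similarity_relation `` {n'}"
    then have "similar_configurations n n'"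
      using eq_equiv_class[OF n(3) equiv_similarity_relation] by (simp add: similarity_relation_def)
    then show "n = n'" using n(1,2) similar_normalized_eq cpx_signed_solution by blast
  qed
  ultimately show ?thesis using card_signed_solutions[OF m] by (simp add: card_image)
qed

text \<open>The sign \<open>h = -1\<close> is a reflection. A half turn swaps the positions of
  vortices 1 and 2, so \<open>e = -1\<close> amounts to interchanging these labels and then
  rotating. Exchanging 3 and 4 reverses the sign of their difference.\<close>

lemma solution_geometrically_equivalent:
  assumes m: "- 1 < m" "m < 1" and z: "z \<in> asymmetric_relative_equilibria m"
  shows "geometrically_equivalent (solution m) z"
proof -
  obtain s where s: "s \<in> signs" "similar_configurations z (signed_solution m s)"
    using equilibrium_similar_signed[OF m z] by blast
  obtain e d h where edh: "s = (e, d, h)" by (cases s)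
  then have sg: "e \<in> {1, -1}" "d \<in> {1, -1}" "h \<in> {1, -1}" using s(1) by (auto simp: signs_def)
  define f where "f = (if h = 1 then id else reflect_configuration)"
  define g where "g = (if e = 1 then id else interchange_vortices 1 2)"
  \<comment> \<open>The half turn for \<open>e = -1\<close> also reverses
    \<open>z\<^sub>3 - z\<^sub>4\<close>, so the interchange of 3 and 4 depends on the product
    \<open>e * d\<close>, not on \<open>d\<close> alone.\<close>
  define k where "k = (if e * d = 1 then id else interchange_vortices 3 4)"
  define A where "A = sqrt (3*m + 5) * sqrt (m + 1)"
  define B where "B = sqrt (3*m + 5) * sqrt (1 - m)"
  define C where "C = sqrt 3 * sqrt (1 - m\<^sup>2)"
  define D where "D = sqrt 3 * (m + 1)"
  note nth = signed_solution_nth[where m = m, folded A_def B_def C_def D_def]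
  have "\<forall>i. cpx (signed_solution m s $ i) = of_real e * cpx (f (g (k (solution m))) $ i) + 0"
    using sg unfolding f_def g_def k_def edh solution_eq_signed forall_4 complex_eq_iff
    by (elim insertE emptyE; hypsubst)
      (simp_all add: reflect_configuration_def interchange_vortices_def transpose_def nth field_simps)
  moreover have "complex_of_real e \<noteq> 0" using sg(1) by auto
  ultimately have "similar_configurations (f (g (k (solution m)))) (signed_solution m s)"
    unfolding similar_configurations_iff by blast
  then have "similar_configurations (f (g (k (solution m)))) z"
    using similar_configurations_trans similar_configurations_sym s(2) by blast
  then show ?thesis
    unfolding geometrically_equivalent_def f_def g_def k_def by (auto split: if_splits)
qed

section \<open>Shape and smoothness\<close>

text \<open>The segment lies on a supporting hyperplane and the other two points lie strictly on one
  side. A convex combination that returns to the hyperplane gives them no weight, so neither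
  endpoint is in the hull of the remaining points.\<close>

lemma supporting_line_edge:
  fixes a b c d n :: "'a::euclidean_space"
  assumes ab: "a \<noteq> b" and n: "n \<bullet> a = \<beta>" "n \<bullet> b = \<beta>" "\<beta> < n \<bullet> c" "\<beta> < n \<bullet> d"
  shows "closed_segment a b edge_of convex hull {a, b, c, d}" "a \<notin> convex hull {b, c, d}" "b \<notin> convex hull {a, c, d}"
proof -
  have cd: "\<beta> < n \<bullet> y" if "y \<in> convex hull {c, d}" for y
  proof -
    have "convex hull {c, d} \<subseteq> {x. \<beta> < n \<bullet> x}"
      by (rule hull_minimal) (use n in \<open>auto simp: convex_halfspace_gt\<close>)
    then show ?thesis using that by auto
  qed
  have "affine hull {a, b} \<subseteq> {x. n \<bullet> x = \<beta>}"
    by (rule hull_minimal) (use n in \<open>auto simp: affine_hyperplane\<close>)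
  moreover have "{a, b, c, d} - {a, b} = {c, d}" using n by auto
  ultimately have "affine hull {a, b} \<inter> convex hull ({a, b, c, d} - {a, b}) = {}"
    using cd by fastforce
  then have "convex hull {a, b} face_of convex hull {a, b, c, d}"
    by (intro face_of_convex_hulls) auto
  then show "closed_segment a b edge_of convex hull {a, b, c, d}"
    unfolding edge_of_def segment_convex_hull using ab by (simp add: aff_dim_convex_hull aff_dim_2)
  have *: "x \<notin> convex hull {y, c, d}" if "n \<bullet> x = \<beta>" "n \<bullet> y = \<beta>" "x \<noteq> y" for x y
  proof
    assume "x \<in> convex hull {y, c, d}"
    then obtain s t w where st: "s + t = 1" "w \<in> convex hull {c, d}" "x = s *\<^sub>R y + t *\<^sub>R w"
      by (auto simp: convex_hull_insert[of "{c, d}" y])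
    have "s * \<beta> + t * (n \<bullet> w) = \<beta>" using st(3) that(1,2) by (simp add: inner_add_right)
    also have "\<beta> = (s + t) * \<beta>" using st(1) by simp
    finally have "t * (n \<bullet> w - \<beta>) = 0" by (simp add: algebra_simps)
    then have "t = 0" using cd[OF st(2)] by simp
    then show False using st that(3) by simp
  qed
  show "a \<notin> convex hull {b, c, d}" "b \<notin> convex hull {a, c, d}" using * n ab by auto
qed

lemma collinear_imp_cross_zero:
  fixes a b c :: "real^2"
  assumes "collinear {a, b, c}"
  shows "(b $ 1 - a $ 1) * (c $ 2 - a $ 2) = (b $ 2 - a $ 2) * (c $ 1 - a $ 1)"
proof -
  have "collinear {0, b - a, c - a}" using assms collinear_3[of b a c] by (simp add: insert_commute)
  then obtain k where "b - a = 0 \<or> c - a = 0 \<or> c - a = k *\<^sub>R (b - a)" unfolding collinear_lemma by auto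
  moreover have "c $ i - a $ i = (c - a) $ i" "b $ i - a $ i = (b - a) $ i" for i by simp_all
  ultimately show ?thesis by (auto simp del: vector_minus_component)
qed

section \<open>Concave and convex position of the given solution\<close>

lemma solution_coords:
  assumes m: "- 1 < m" "m < 1"
  defines "A \<equiv> sqrt (3*m + 5)" and "B \<equiv> sqrt (m + 1)" and "C \<equiv> sqrt (1 - m)" and "D \<equiv> sqrt 3"
  shows "solution m $ 1 $ 1 = 1" "solution m $ 1 $ 2 = 0" "solution m $ 2 $ 1 = - 1" "solution m $ 2 $ 2 = 0"
    "solution m $ 3 $ 1 = A * (B - C) / 2" "solution m $ 3 $ 2 = D * B * (B + C) / 2"
    "solution m $ 4 $ 1 = A * (B + C) / 2" "solution m $ 4 $ 2 = D * B * (C - B) / 2"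
    "B\<^sup>2 + C\<^sup>2 = 2" "A > B" "B > 0" "C > 0" "D > 0"
proof -
  have m': "m = B * B - 1" using m by (simp add: B_def)
  have "1 - m\<^sup>2 = (m + 1) * (1 - m)" by algebra
  then have BC: "sqrt (1 - m\<^sup>2) = B * C" by (simp add: B_def C_def real_sqrt_mult)
  show "solution m $ 1 $ 1 = 1" "solution m $ 1 $ 2 = 0" "solution m $ 2 $ 1 = - 1" "solution m $ 2 $ 2 = 0"
    "solution m $ 3 $ 1 = A * (B - C) / 2" "solution m $ 3 $ 2 = D * B * (B + C) / 2"
    "solution m $ 4 $ 1 = A * (B + C) / 2" "solution m $ 4 $ 2 = D * B * (C - B) / 2"
    unfolding solution_def vector_4 BC A_def[symmetric] B_def[symmetric] C_def[symmetric] D_def[symmetric]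
    by (simp_all add: m' algebra_simps)
  show "B\<^sup>2 + C\<^sup>2 = 2" "A > B" "B > 0" "C > 0" "D > 0" using m by (simp_all add: A_def B_def C_def D_def)
qed

lemma solution_concave:
  assumes m: "0 < m" "m < 1"
  shows "concave_with_interior_vortex 1 (solution m)"
proof -
  define A where "A = sqrt (3*m + 5)"
  define B where "B = sqrt (m + 1)"
  define C where "C = sqrt (1 - m)"
  define D where "D = sqrt 3"
  have "- 1 < m" using m by simp
  note s = solution_coords[OF this m(2), folded A_def B_def C_def D_def]
  have BC: "C < B" using m by (simp add: B_def C_def)
  have A: "A > 0" using s(10,11) by linarith
  have pos: "A * (B - C) / 2 > 0" "D * B * (B + C) / 2 > 0" "A * (B + C) / 2 > 0" "D * B * (C - B) / 2 < 0"
    using s(9-13) BC A by (simp_all add: mult_pos_neg)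
  have img: "($) (solution m) ` (UNIV - {1}) = {solution m $ 2, solution m $ 3, solution m $ 4}"
  proof -
    have "UNIV - {1} = {2, 3, 4 :: 4}" unfolding UNIV_4 by auto
    then show ?thesis by simp
  qed
  have nc: "\<not> collinear {solution m $ 2, solution m $ 3, solution m $ 4}"
  proof
    assume "collinear {solution m $ 2, solution m $ 3, solution m $ 4}"
    from collinear_imp_cross_zero[OF this]
    have "(A * (B - C) / 2 + 1) * (D * B * (C - B) / 2) = (D * B * (B + C) / 2) * (A * (B + C) / 2 + 1)"
      unfolding s by simp
    moreover have "(A * (B - C) / 2 + 1) * (D * B * (C - B) / 2) < 0"
      using pos by (intro mult_pos_neg) auto
    moreover have "(D * B * (B + C) / 2) * (A * (B + C) / 2 + 1) > 0"
      using pos by (intro mult_pos_pos) auto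
    ultimately show False by linarith
  qed
  \<comment> \<open>\<open>x\<close>, \<open>y\<close> and \<open>w\<close> are the barycentric
    coordinates of vortex 1 in the triangle of vortices 2, 3 and 4; they are positive because
    \<open>A > B > C > 0\<close>.\<close>
  define x where "x = (A - B) / (A + B)"
  define y where "y = (B - C) / (A + B)"
  define w where "w = (B + C) / (A + B)"
  have AB: "A + B \<noteq> 0" using A s(11) by simp
  have xyw: "0 < x" "0 < y" "0 < w"
    using A s(9-13) BC AB unfolding x_def y_def w_def by simp_all
  have 1: "(A + B) * x = A - B" "(A + B) * y = B - C" "(A + B) * w = B + C"
    using AB unfolding x_def y_def w_def by simp_all
  then have "(A + B) * (x + y + w) = (A + B) * 1" by (simp only: ring_distribs)
  then have sum: "x + y + w = 1" using AB unfolding mult_cancel_left by simp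
  have "(A + B) * (- x + y * (A * (B - C) / 2) + w * (A * (B + C) / 2)) = (A + B) * 1"
  proof -
    have "(A + B) * (- x + y * (A * (B - C) / 2) + w * (A * (B + C) / 2)) =
      - ((A + B) * x) + ((A + B) * y) * (A * (B - C) / 2) + ((A + B) * w) * (A * (B + C) / 2)"
      by (simp add: field_simps)
    also have "\<dots> = - (A - B) + A * (B\<^sup>2 + C\<^sup>2)" unfolding 1 by (simp add: field_simps power2_eq_square)
    finally show ?thesis using s(9) by simp
  qed
  then have 2: "- x + y * (A * (B - C) / 2) + w * (A * (B + C) / 2) = 1" using AB unfolding mult_cancel_left by simp
  have "(A + B) * (y * (D * B * (B + C) / 2) + w * (D * B * (C - B) / 2)) = 0"
  proof -
    have "(A + B) * (y * (D * B * (B + C) / 2) + w * (D * B * (C - B) / 2)) =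
      ((A + B) * y) * (D * B * (B + C) / 2) + ((A + B) * w) * (D * B * (C - B) / 2)"
      by (simp add: field_simps)
    also have "\<dots> = 0" unfolding 1 by (simp add: field_simps)
    finally show ?thesis .
  qed
  then have 3: "y * (D * B * (B + C) / 2) + w * (D * B * (C - B) / 2) = 0" using AB by simp
  have "x *\<^sub>R solution m $ 2 + y *\<^sub>R solution m $ 3 + w *\<^sub>R solution m $ 4 = solution m $ 1"
    using 2 3 by (simp add: vec_eq_iff forall_2 s)
  moreover have "interior (convex hull {solution m $ 2, solution m $ 3, solution m $ 4}) =
    {v. \<exists>x y z. 0 < x \<and> 0 < y \<and> 0 < z \<and> x + y + z = 1 \<and>
      x *\<^sub>R solution m $ 2 + y *\<^sub>R solution m $ 3 + z *\<^sub>R solution m $ 4 = v}"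
    using nc by (rule interior_convex_hull_3_minimal) simp
  ultimately show ?thesis
    unfolding concave_with_interior_vortex_def img using xyw sum by blast
qed

text \<open>Both the line through vortices 1, 2 and the line through 3, 4 leave the other pair
  strictly on one side, so \<open>supporting_line_edge\<close> yields both edges and covers all four
  vertices.\<close>

lemma solution_convex:
  assumes m: "- 1 < m" "m < 0"
  shows "convex_configuration (solution m)" "adjacent_vertices 1 2 (solution m)" "adjacent_vertices 3 4 (solution m)"
proof -
  define A where "A = sqrt (3*m + 5)"
  define B where "B = sqrt (m + 1)"
  define C where "C = sqrt (1 - m)"
  define D where "D = sqrt 3"
  have "m < 1" using m by simp
  note s = solution_coords[OF m(1) this, folded A_def B_def C_def D_def]
  define z where "z = solution m"
  note s = s[folded z_def]
  have BC: "B < C" using m by (simp add: B_def C_def)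
  have inner: "vector [a, b] \<bullet> x = a * x $ 1 + b * x $ 2" for a b :: real and x :: "real^2"
    by (simp add: inner_vec_def sum_2)
  have "z $ 1 \<noteq> z $ 2" using s by (auto simp: vec_eq_iff forall_2)
  moreover have "vector [0, 1] \<bullet> z $ 1 = 0" "vector [0, 1] \<bullet> z $ 2 = 0" "0 < vector [0, 1] \<bullet> z $ 3" "0 < vector [0, 1] \<bullet> z $ 4"
    unfolding inner s using s(9-13) BC by simp_all
  ultimately have e12: "closed_segment (z $ 1) (z $ 2) edge_of convex hull {z $ 1, z $ 2, z $ 3, z $ 4}"
    "z $ 1 \<notin> convex hull {z $ 2, z $ 3, z $ 4}" "z $ 2 \<notin> convex hull {z $ 1, z $ 3, z $ 4}"
    by (rule supporting_line_edge)+
  have AC: "A * C \<noteq> 0" using s(10-12) by simp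
  have "z $ 3 $ 1 - z $ 4 $ 1 = - (A * C)" unfolding s by (simp add: field_simps)
  then have "z $ 3 \<noteq> z $ 4" using AC by auto
  \<comment> \<open>The line through vortices 3 and 4 has normal
    \<open>vector [- (D * B\<^sup>2), - (A * C)]\<close> and level \<open>- (A * D * B)\<close>.
    Vortices 1 and 2 lie at levels \<open>- (D * B\<^sup>2)\<close> and
    \<open>D * B\<^sup>2\<close>, both strictly above it since \<open>A > B\<close>.\<close>
  moreover have "- (A * D * B) < - (D * B\<^sup>2)" "- (A * D * B) < D * B\<^sup>2"
  proof -
    have "D * B * B < D * B * A" using s(10-13) by (intro mult_strict_left_mono) simp_all
    then show "- (A * D * B) < - (D * B\<^sup>2)" by (simp add: power2_eq_square mult_ac)
    moreover have "- (D * B\<^sup>2) < D * B\<^sup>2" using s(11,13) by simp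
    ultimately show "- (A * D * B) < D * B\<^sup>2" by linarith
  qed
  moreover have "vector [- (D * B\<^sup>2), - (A * C)] \<bullet> z $ 3 = - (A * D * B)" "vector [- (D * B\<^sup>2), - (A * C)] \<bullet> z $ 4 = - (A * D * B)"
  proof -
    have "vector [- (D * B\<^sup>2), - (A * C)] \<bullet> z $ 3 = - (A * D * B) * (B\<^sup>2 + C\<^sup>2) / 2"
      "vector [- (D * B\<^sup>2), - (A * C)] \<bullet> z $ 4 = - (A * D * B) * (B\<^sup>2 + C\<^sup>2) / 2"
      unfolding inner s(1-8) by (simp_all add: field_simps power2_eq_square)
    then show "vector [- (D * B\<^sup>2), - (A * C)] \<bullet> z $ 3 = - (A * D * B)" "vector [- (D * B\<^sup>2), - (A * C)] \<bullet> z $ 4 = - (A * D * B)"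
      by (simp_all add: s(9))
  qed
  moreover have "vector [- (D * B\<^sup>2), - (A * C)] \<bullet> z $ 1 = - (D * B\<^sup>2)" "vector [- (D * B\<^sup>2), - (A * C)] \<bullet> z $ 2 = D * B\<^sup>2"
    unfolding inner s by simp_all
  ultimately have e34: "closed_segment (z $ 3) (z $ 4) edge_of convex hull {z $ 3, z $ 4, z $ 1, z $ 2}"
    "z $ 3 \<notin> convex hull {z $ 4, z $ 1, z $ 2}" "z $ 4 \<notin> convex hull {z $ 3, z $ 1, z $ 2}"
    using supporting_line_edge[of "z $ 3" "z $ 4" "vector [- (D * B\<^sup>2), - (A * C)]" "- (A * D * B)" "z $ 1" "z $ 2"] by simp_all
  have sets: "{z $ 3, z $ 4, z $ 1, z $ 2} = {z $ 1, z $ 2, z $ 3, z $ 4}" "{z $ 4, z $ 1, z $ 2} = {z $ 1, z $ 2, z $ 4}"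
    "{z $ 3, z $ 1, z $ 2} = {z $ 1, z $ 2, z $ 3}" by auto
  note e34 = e34(1)[unfolded sets(1)] e34(2)[unfolded sets(2)] e34(3)[unfolded sets(3)]
  have U: "UNIV - {1} = {2, 3, 4 :: 4}" "UNIV - {2} = {1, 3, 4 :: 4}" "UNIV - {3} = {1, 2, 4 :: 4}" "UNIV - {4} = {1, 2, 3 :: 4}"
    unfolding UNIV_4 by auto
  show "convex_configuration (solution m)"
    unfolding convex_configuration_def forall_4 z_def[symmetric] U using e12 e34 by simp
  show "adjacent_vertices 1 2 (solution m)" "adjacent_vertices 3 4 (solution m)"
    unfolding adjacent_vertices_def z_def[symmetric] range_nth_4 using e12 e34 by simp_all
qed

section \<open>Differentiability of every finite order\<close>

text \<open>Supplying the derivative as a witness instead of iterating \<open>deriv\<close> lets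
  sums and products be handled by induction on the order.\<close>

primrec times_differentiable_on :: "nat \<Rightarrow> (real \<Rightarrow> real) \<Rightarrow> real set \<Rightarrow> bool" where
  "times_differentiable_on 0 f U \<longleftrightarrow> True"
| "times_differentiable_on (Suc n) f U \<longleftrightarrow>
     (\<exists>g. (\<forall>x\<in>U. (f has_real_derivative g x) (at x)) \<and> times_differentiable_on n g U)"

lemma times_differentiable_on_SucI:
  assumes "\<And>x. x \<in> U \<Longrightarrow> (f has_real_derivative g x) (at x)" "times_differentiable_on n g U"
  shows "times_differentiable_on (Suc n) f U"
  using assms by auto

lemma times_differentiable_on_SucD:
  "times_differentiable_on (Suc n) f U \<Longrightarrow> times_differentiable_on n f U"
proof (induction n arbitrary: f)
  case (Suc n)
  then obtain g where "\<forall>x\<in>U. (f has_real_derivative g x) (at x)" "times_differentiable_on (Suc n) g U"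
    unfolding times_differentiable_on.simps(2)[of "Suc n"] by blast
  then show ?case using Suc.IH[of g] unfolding times_differentiable_on.simps(2)[of n f] by blast
qed simp

lemma times_differentiable_on_cong:
  assumes "open U" "\<And>x. x \<in> U \<Longrightarrow> f x = g x" "times_differentiable_on n f U"
  shows "times_differentiable_on n g U"
proof (cases n)
  case (Suc k)
  then obtain f' where f': "\<forall>x\<in>U. (f has_real_derivative f' x) (at x)" "times_differentiable_on k f' U"
    using assms(3) by auto
  have "(g has_real_derivative f' x) (at x)" if "x \<in> U" for x
    using f'(1) that assms(1,2) has_field_derivative_transform_within_open by blast
  then show ?thesis using f'(2) Suc by auto
qed simp

lemma times_differentiable_on_const: "times_differentiable_on n (\<lambda>x. c) U"
proof (induction n arbitrary: c)
  case (Suc n)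
  then show ?case by (auto intro!: exI[of _ "\<lambda>x. 0"])
qed simp

lemma times_differentiable_on_add:
  "times_differentiable_on n f U \<Longrightarrow> times_differentiable_on n g U \<Longrightarrow> times_differentiable_on n (\<lambda>x. f x + g x) U"
proof (induction n arbitrary: f g)
  case (Suc n)
  then obtain f' g' where *: "\<forall>x\<in>U. (f has_real_derivative f' x) (at x)" "times_differentiable_on n f' U"
    "\<forall>x\<in>U. (g has_real_derivative g' x) (at x)" "times_differentiable_on n g' U" by auto
  show ?case
  proof (rule times_differentiable_on_SucI)
    show "((\<lambda>x. f x + g x) has_real_derivative f' x + g' x) (at x)" if "x \<in> U" for x
      using * that by (intro DERIV_add) auto
    show "times_differentiable_on n (\<lambda>x. f' x + g' x) U" using Suc.IH[OF *(2,4)] .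
  qed
qed simp

lemma times_differentiable_on_mult:
  "times_differentiable_on n f U \<Longrightarrow> times_differentiable_on n g U \<Longrightarrow> times_differentiable_on n (\<lambda>x. f x * g x) U"
proof (induction n arbitrary: f g)
  case (Suc n)
  then obtain f' g' where *: "\<forall>x\<in>U. (f has_real_derivative f' x) (at x)" "times_differentiable_on n f' U"
    "\<forall>x\<in>U. (g has_real_derivative g' x) (at x)" "times_differentiable_on n g' U" by auto
  have "times_differentiable_on n (\<lambda>x. f' x * g x + g' x * f x) U"
    using times_differentiable_on_add[OF Suc.IH[OF *(2) times_differentiable_on_SucD[OF Suc.prems(2)]]
      Suc.IH[OF *(4) times_differentiable_on_SucD[OF Suc.prems(1)]]] .
  then show ?case
    using *(1,3) by (intro times_differentiable_on_SucI[OF DERIV_mult]) auto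
qed simp

lemma times_differentiable_on_affine: "times_differentiable_on n (\<lambda>x. a * x + b) U"
proof (cases n)
  case (Suc k)
  have "\<forall>x\<in>U. ((\<lambda>x. a * x + b) has_real_derivative a) (at x)"
    by (auto intro!: derivative_eq_intros)
  then show ?thesis unfolding Suc using times_differentiable_on_const[of k a U] by auto
qed simp

text \<open>Up to constants, real powers of a positive affine function are closed under
  differentiation, whereas square roots are not; hence the induction over all exponents
  \<open>r\<close>.\<close>

lemma times_differentiable_on_affine_powr:
  assumes "\<And>x. x \<in> U \<Longrightarrow> a * x + b > 0"
  shows "times_differentiable_on n (\<lambda>x. (a * x + b) powr r) U"
proof (induction n arbitrary: r)
  case (Suc n)
  have "((\<lambda>x. (a * x + b) powr r) has_real_derivative (r * a) * (a * x + b) powr (r - 1)) (at x)" if "x \<in> U" for x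
    using assms[OF that] by (auto intro!: derivative_eq_intros simp: powr_diff field_simps)
  moreover have "times_differentiable_on n (\<lambda>x. (r * a) * (a * x + b) powr (r - 1)) U"
    using times_differentiable_on_mult[OF times_differentiable_on_const Suc] .
  ultimately show ?case by (rule times_differentiable_on_SucI)
qed simp

lemma times_differentiable_on_affine_sqrt:
  assumes "open U" "\<And>x. x \<in> U \<Longrightarrow> a * x + b > 0"
  shows "times_differentiable_on n (\<lambda>x. sqrt (a * x + b)) U"
proof (rule times_differentiable_on_cong[OF assms(1)])
  show "times_differentiable_on n (\<lambda>x. (a * x + b) powr (1/2)) U"
    by (rule times_differentiable_on_affine_powr) (rule assms(2))
  show "(a * x + b) powr (1/2) = sqrt (a * x + b)" if "x \<in> U" for x
    using assms(2)[OF that] by (simp add: powr_half_sqrt)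
qed

text \<open>On \<open>U\<close> the witness agrees with \<open>deriv f\<close>. Openness of
  \<open>U\<close> allows the one to be replaced by the other under further differentiation.\<close>

lemma times_differentiable_on_imp_differentiable:
  assumes "open U" "times_differentiable_on (Suc k) f U" "x \<in> U"
  shows "(deriv ^^ k) f differentiable (at x)"
  using assms(2)
proof (induction k arbitrary: f)
  case 0
  then show ?case using assms(3) by (auto simp: real_differentiable_def)
next
  case (Suc k)
  then obtain g where g: "\<forall>x\<in>U. (f has_real_derivative g x) (at x)" "times_differentiable_on (Suc k) g U"
    unfolding times_differentiable_on.simps(2)[of "Suc k"] by blast
  have "g x = deriv f x" if "x \<in> U" for x using g(1) that DERIV_imp_deriv by metis
  then have "times_differentiable_on (Suc k) (deriv f) U"
    using times_differentiable_on_cong[OF assms(1) _ g(2)] by simp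
  then show ?case using Suc.IH by (simp add: funpow_swap1)
qed

lemma solution_smooth:
  assumes "i \<in> {3, 4}"
  shows "smooth_at (\<lambda>t. solution t $ i $ k) 0"
proof -
  define U where "U = {-1<..<1::real}"
  have U: "open U" "0 \<in> U" by (auto simp: U_def)
  note sq = times_differentiable_on_affine_sqrt[OF U(1)]
  define A where "A t = sqrt (3 * t + 5)" for t :: real
  define B where "B t = sqrt (1 * t + 1)" for t :: real
  define C where "C t = sqrt ((- 1) * t + 1)" for t :: real
  have td: "times_differentiable_on n A U" "times_differentiable_on n B U" "times_differentiable_on n C U" for n
    unfolding A_def B_def C_def by (intro sq; auto simp: U_def)+
  have "1 - t\<^sup>2 = (t + 1) * (1 - t)" for t :: real by algebra
  then have BC: "sqrt (1 - t\<^sup>2) = B t * C t" for t by (simp add: B_def C_def real_sqrt_mult)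
  have sol: "(\<lambda>t. solution t $ 3 $ 1) = (\<lambda>t. 1/2 * A t * (B t + (- 1) * C t))"
    "(\<lambda>t. solution t $ 3 $ 2) = (\<lambda>t. sqrt 3 / 2 * ((1 * t + 1) + B t * C t))"
    "(\<lambda>t. solution t $ 4 $ 1) = (\<lambda>t. 1/2 * A t * (B t + C t))"
    "(\<lambda>t. solution t $ 4 $ 2) = (\<lambda>t. - (sqrt 3 / 2) * ((1 * t + 1) + (- 1) * (B t * C t)))"
    unfolding solution_def vector_4 BC by (simp_all add: A_def B_def C_def)
  have "times_differentiable_on n (\<lambda>t. solution t $ i $ k) U" for n
    using assms exhaust_2[of k]
    by (auto simp only: insert_iff empty_iff sol intro!: times_differentiable_on_add times_differentiable_on_mult
      times_differentiable_on_const times_differentiable_on_affine td)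
  then have "(deriv ^^ j) (\<lambda>t. solution t $ i $ k) differentiable (at x)" if "x \<in> U" for j x
    using times_differentiable_on_imp_differentiable[OF U(1) _ that] by blast
  then show ?thesis unfolding smooth_at_def using U by blast
qed

theorem theorem4p5:
  fixes m :: real
  assumes "- 1 < m" and "m < 1"
  shows
    "relative_equilibrium_with (circulations m) (1 / 2) (solution m) \<and> asymmetric (solution m) \<and>
     (0 < m \<longrightarrow> concave_with_interior_vortex 1 (solution m)) \<and>
     (m < 0 \<longrightarrow> convex_configuration (solution m) \<and>
        adjacent_vertices 1 2 (solution m) \<and> adjacent_vertices 3 4 (solution m)) \<and>
     (\<forall>i\<in>{3, 4}. \<forall>k. smooth_at (\<lambda>t. solution t $ i $ k) 0) \<and>
     (\<forall>z \<omega>. relative_equilibrium_with (circulations m) \<omega> z \<and> asymmetric z \<and>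
        z $ 1 = vector [1, 0] \<and> z $ 2 = vector [- 1, 0] \<longrightarrow> \<omega> = 1 / 2) \<and>
     card (asymmetric_relative_equilibria m // similarity_relation) = 8 \<and>
     (\<forall>z \<in> asymmetric_relative_equilibria m. geometrically_equivalent (solution m) z)"
proof (intro conjI impI ballI allI)
  note m = assms
  have s: "(1, 1, 1) \<in> signs" by (simp add: signs_def)
  show "relative_equilibrium_with (circulations m) (1 / 2) (solution m)" "asymmetric (solution m)"
    using signed_solution_equilibrium[OF m s] by (simp_all add: solution_eq_signed)
  show "concave_with_interior_vortex 1 (solution m)" if "0 < m"
    using solution_concave that m(2) by blast
  show "convex_configuration (solution m)" "adjacent_vertices 1 2 (solution m)" "adjacent_vertices 3 4 (solution m)"
    if "m < 0"
    using solution_convex[OF m(1) that] by blast+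
  show "smooth_at (\<lambda>t. solution t $ i $ k) 0" if "i \<in> {3, 4}" for i k
    using solution_smooth[OF that] .
  show "\<omega> = 1 / 2"
    if z: "relative_equilibrium_with (circulations m) \<omega> z \<and> asymmetric z \<and> z $ 1 = vector [1, 0] \<and> z $ 2 = vector [- 1, 0]" for z \<omega>
  proof -
    have "cpx (z $ 1) = 1" "cpx (z $ 2) = - 1" using z by (simp_all add: complex_eq_iff)
    then show ?thesis using asymmetric_equilibrium(1)[OF m _ _ refl refl] z by blast
  qed
  show "card (asymmetric_relative_equilibria m // similarity_relation) = 8"
    using card_asymmetric_classes[OF m] .
  show "geometrically_equivalent (solution m) z" if "z \<in> asymmetric_relative_equilibria m" for z
    using solution_geometrically_equivalent[OF m that] .
qed

end
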